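(* Let $F=\alpha+\beta$ be a Randers metric of Berwald type on a 4-dimensional manifold $M$. Then the vacuum field equation of Finsler gravity for $F$ is equivalent to Ricci-flatness, i.e. $$\left(Lg^{\mu\nu}-3y^\mu y^\nu\right)R_{\mu\nu}=0\quad\Longleftrightarrow\quad R_{\mu\nu}=0\quad\Longleftrightarrow\quad\mathrm{Ric}=0,$$ each equation being required to hold on the whole domain $\mathcal A$ of $F$.
   Context: Coordinates $x^\mu$ on $M$ induce coordinates $(x^\mu,y^\mu)$ on $TM$; $\partial_\mu=\partial/\partial x^\mu$, $\bar\partial_\mu=\partial/\partial y^\mu$. A conic subbundle $\mathcal A\subset TM$ is an open subset projecting onto $M$ and closed under $(x,y)\mapsto(x,\lambda y)$, $\lambda>0$. A Finsler metric on $\mathcal A$ is a smooth $F:\mathcal A\to\mathbb R$ with $F(x,\lambda y)=\lambda F(x,y)$ for $\lambda>0$ and $g_{\mu\nu}=\tfrac12\bar\partial_\mu\bar\partial_\nu F^2$ nondegenerate; $L=F^2$. Canonical nonlinear connection: $N^\rho_\mu=\tfrac14\bar\partial_\mu[g^{\rho\sigma}(y^\lambda\partial_\lambda\bar\partial_\sigma L-\partial_\sigma L)]$; $\delta_\mu=\partial_\mu-N^\rho_\mu\bar\partial_\rho$. $F$ is of Berwald type if $N^\rho_\mu=\Gamma^\rho_{\mu\nu}(x)y^\nu$ for functions $\Gamma^\rho_{\mu\nu}$ on $M$. Curvatures: $R^\rho_{\mu\nu}=\delta_\mu N^\rho_\nu-\delta_\nu N^\rho_\mu$, $\mathrm{Ric}=R^\mu_{\mu\nu}y^\nu$,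 $R_{\mu\nu}=\tfrac12\bar\partial_\mu\bar\partial_\nu\mathrm{Ric}$. A Randers metric is a Finsler metric of the form $F=\alpha+\beta$ with $\alpha=\sqrt{|a_{\mu\nu}y^\mu y^\nu|}$, $a_{\mu\nu}$ a Lorentzian metric on $M$, $\beta=b_\mu y^\mu$, $b$ a smooth 1-form, where $\alpha\neq0$ on $\mathcal A$. For Berwald metrics in dimension 4 the (Pfeifer-Wohlfarth) vacuum field equation of Finsler gravity is $(Lg^{\mu\nu}-3y^\mu y^\nu)R_{\mu\nu}=0$. *)

theory Defs
  imports "HOL-Analysis.Analysis"
begin

section \<open>Smooth maps and 4-dimensional smooth manifolds\<close>

text \<open>Both predicates are only meaningful for open S.\<close>

primrec ck_on :: "nat \<Rightarrow> 'a::real_normed_vector set \<Rightarrow> ('a \<Rightarrow> 'b::real_normed_vector) \<Rightarrow> bool" where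
  "ck_on 0 S f \<longleftrightarrow> continuous_on S f"
| "ck_on (Suc k) S f \<longleftrightarrow> (\<forall>x\<in>S. f differentiable (at x)) \<and>
     (\<forall>v. ck_on k S (\<lambda>x. frechet_derivative f (at x) v))"

definition smooth_on :: "'a::real_normed_vector set \<Rightarrow> ('a \<Rightarrow> 'b::real_normed_vector) \<Rightarrow> bool" where
  "smooth_on S f \<longleftrightarrow> (\<forall>k. ck_on k S f)"

text \<open>A chart is a domain U together with a coordinate map, which is only meaningful on U.\<close>

type_synonym 'm chart = "'m set \<times> ('m \<Rightarrow> real^4)"

definition chart_image :: "'m chart \<Rightarrow> (real^4) set" where
  "chart_image c = snd c ` fst c"

definition transition :: "'m chart \<Rightarrow> 'm chart \<Rightarrow> real^4 \<Rightarrow> real^4" where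
  "transition c d = snd d \<circ> inv_into (fst c) (snd c)"

definition overlap :: "'m chart \<Rightarrow> 'm chart \<Rightarrow> (real^4) set" where
  "overlap c d = snd c ` (fst c \<inter> fst d)"

definition is_chart :: "'m topology \<Rightarrow> 'm chart \<Rightarrow> bool" where
  "is_chart M c \<longleftrightarrow> openin M (fst c) \<and> open (chart_image c) \<and>
     homeomorphic_map (subtopology M (fst c)) (top_of_set (chart_image c)) (snd c)"

definition smooth_manifold4 :: "'m topology \<Rightarrow> 'm chart set \<Rightarrow> bool" where
  "smooth_manifold4 M \<A> \<longleftrightarrow> Hausdorff_space M \<and> second_countable M \<and>
     (\<forall>c\<in>\<A>. is_chart M c) \<and> (\<Union>c\<in>\<A>. fst c) = topspace M \<and>
     (\<forall>c\<in>\<A>. \<forall>d\<in>\<A>. smooth_on (overlap c d) (transition c d))"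

section \<open>Tangent bundle\<close>

text \<open>A tangent vector at p is the family of its component vectors in all charts around p,
  transforming with the Jacobians of the coordinate changes. The entries at all other
  arguments are set to 0, so that a vector is determined by its components.\<close>

type_synonym 'm tvec = "'m \<times> ('m chart \<Rightarrow> real^4)"

definition tangent_bundle :: "'m topology \<Rightarrow> 'm chart set \<Rightarrow> 'm tvec set" where
  "tangent_bundle M \<A> = {(p, v). p \<in> topspace M \<and>
     (\<forall>c. \<not> (c \<in> \<A> \<and> p \<in> fst c) \<longrightarrow> v c = 0) \<and>
     (\<forall>c\<in>\<A>. \<forall>d\<in>\<A>. p \<in> fst c \<inter> fst d \<longrightarrow>
        v d = jacobian (transition c d) (at (snd c p)) *v v c)}"

definition tscale :: "real \<Rightarrow> 'm tvec \<Rightarrow> 'm tvec" where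
  "tscale l w = (fst w, \<lambda>c. l *\<^sub>R snd w c)"

definition over :: "'m chart \<Rightarrow> 'm tvec set \<Rightarrow> 'm tvec set" where
  "over c W = {w \<in> W. fst w \<in> fst c}"

text \<open>The induced coordinates (x, y) on the tangent bundle.\<close>

definition tcoord :: "'m chart \<Rightarrow> 'm tvec \<Rightarrow> (real^4) \<times> (real^4)" where
  "tcoord c w = (snd c (fst w), snd w c)"

definition coord_image :: "'m chart \<Rightarrow> 'm tvec set \<Rightarrow> ((real^4) \<times> (real^4)) set" where
  "coord_image c W = tcoord c ` over c W"

definition local_rep ::
  "'m topology \<Rightarrow> 'm chart set \<Rightarrow> 'm chart \<Rightarrow> ('m tvec \<Rightarrow> real) \<Rightarrow> (real^4) \<times> (real^4) \<Rightarrow> real" where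
  "local_rep M \<A> c F = F \<circ> inv_into (over c (tangent_bundle M \<A>)) (tcoord c)"

definition conic_subbundle :: "'m topology \<Rightarrow> 'm chart set \<Rightarrow> 'm tvec set \<Rightarrow> bool" where
  "conic_subbundle M \<A> W \<longleftrightarrow> W \<subseteq> tangent_bundle M \<A> \<and>
     (\<forall>c\<in>\<A>. open (coord_image c W)) \<and> fst ` W = topspace M \<and>
     (\<forall>w\<in>W. \<forall>l>0. tscale l w \<in> W)"

section \<open>Finsler geometry in induced coordinates\<close>

type_synonym cfun = "(real^4) \<times> (real^4) \<Rightarrow> real"

definition dx :: "4 \<Rightarrow> cfun \<Rightarrow> cfun" where
  "dx \<mu> f z = deriv (\<lambda>t. f (fst z + t *\<^sub>R axis \<mu> 1, snd z)) 0"

definition dy :: "4 \<Rightarrow> cfun \<Rightarrow> cfun" where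
  "dy \<mu> f z = deriv (\<lambda>t. f (fst z, snd z + t *\<^sub>R axis \<mu> 1)) 0"

definition lagr :: "cfun \<Rightarrow> cfun" where
  "lagr F z = (F z)\<^sup>2"

definition fund_tensor :: "cfun \<Rightarrow> (real^4) \<times> (real^4) \<Rightarrow> real^4^4" where
  "fund_tensor F z = (\<chi> \<mu> \<nu>. 1/2 * dy \<mu> (dy \<nu> (lagr F)) z)"

definition fund_tensor_inv :: "cfun \<Rightarrow> (real^4) \<times> (real^4) \<Rightarrow> real^4^4" where
  "fund_tensor_inv F z = matrix_inv (fund_tensor F z)"

text \<open>\<open>nl_conn F \<rho> \<mu>\<close> is the coefficient with upper index \<open>\<rho>\<close> and lower index \<open>\<mu>\<close>.\<close>

definition nl_conn :: "cfun \<Rightarrow> 4 \<Rightarrow> 4 \<Rightarrow> cfun" where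
  "nl_conn F \<rho> \<mu> = (\<lambda>z. 1/4 * dy \<mu> (\<lambda>q. \<Sum>\<sigma>\<in>UNIV. fund_tensor_inv F q $ \<rho> $ \<sigma> *
     ((\<Sum>\<kappa>\<in>UNIV. snd q $ \<kappa> * dx \<kappa> (dy \<sigma> (lagr F)) q) - dx \<sigma> (lagr F) q)) z)"

definition hor :: "cfun \<Rightarrow> 4 \<Rightarrow> cfun \<Rightarrow> cfun" where
  "hor F \<mu> f z = dx \<mu> f z - (\<Sum>\<rho>\<in>UNIV. nl_conn F \<rho> \<mu> z * dy \<rho> f z)"

definition nl_curv :: "cfun \<Rightarrow> 4 \<Rightarrow> 4 \<Rightarrow> 4 \<Rightarrow> cfun" where
  "nl_curv F \<rho> \<mu> \<nu> z = hor F \<mu> (nl_conn F \<rho> \<nu>) z - hor F \<nu> (nl_conn F \<rho> \<mu>) z"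

definition ricci_scalar :: "cfun \<Rightarrow> cfun" where
  "ricci_scalar F z = (\<Sum>\<mu>\<in>UNIV. \<Sum>\<nu>\<in>UNIV. nl_curv F \<mu> \<mu> \<nu> z * snd z $ \<nu>)"

definition ricci_tensor :: "cfun \<Rightarrow> 4 \<Rightarrow> 4 \<Rightarrow> cfun" where
  "ricci_tensor F \<mu> \<nu> z = 1/2 * dy \<mu> (dy \<nu> (ricci_scalar F)) z"

definition field_eq_lhs :: "cfun \<Rightarrow> cfun" where
  "field_eq_lhs F z = (\<Sum>\<mu>\<in>UNIV. \<Sum>\<nu>\<in>UNIV.
     (lagr F z * fund_tensor_inv F z $ \<mu> $ \<nu> - 3 * snd z $ \<mu> * snd z $ \<nu>) * ricci_tensor F \<mu> \<nu> z)"

section \<open>Finsler, Berwald and Randers metrics on a manifold\<close>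

definition finsler_metric ::
  "'m topology \<Rightarrow> 'm chart set \<Rightarrow> 'm tvec set \<Rightarrow> ('m tvec \<Rightarrow> real) \<Rightarrow> bool" where
  "finsler_metric M \<A> W F \<longleftrightarrow>
     (\<forall>c\<in>\<A>. smooth_on (coord_image c W) (local_rep M \<A> c F)) \<and>
     (\<forall>w\<in>W. \<forall>l>0. F (tscale l w) = l * F w) \<and>
     (\<forall>c\<in>\<A>. \<forall>z\<in>coord_image c W. det (fund_tensor (local_rep M \<A> c F) z) \<noteq> 0)"

definition berwald_type ::
  "'m topology \<Rightarrow> 'm chart set \<Rightarrow> 'm tvec set \<Rightarrow> ('m tvec \<Rightarrow> real) \<Rightarrow> bool" where
  "berwald_type M \<A> W F \<longleftrightarrow> (\<forall>c\<in>\<A>. \<exists>\<Gamma> :: 4 \<Rightarrow> 4 \<Rightarrow> 4 \<Rightarrow> real^4 \<Rightarrow> real.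
     \<forall>z\<in>coord_image c W. \<forall>\<rho> \<mu>.
       nl_conn (local_rep M \<A> c F) \<rho> \<mu> z = (\<Sum>\<nu>\<in>UNIV. \<Gamma> \<rho> \<mu> \<nu> (fst z) * snd z $ \<nu>))"

text \<open>Covariant tensor fields are given by their components \<open>a c x\<close> and \<open>b c x\<close> at the point
  with coordinates x in the chart c. By Sylvester's law of inertia, the congruence below says
  that \<open>a c x\<close> is symmetric of signature (-,+,+,+), for s = 1, or (+,-,-,-), for s = -1.
  Both sign conventions are admitted, but the same one is used on all of M.\<close>

definition lorentzian_metric ::
  "'m chart set \<Rightarrow> ('m chart \<Rightarrow> real^4 \<Rightarrow> real^4^4) \<Rightarrow> bool" where
  "lorentzian_metric \<A> a \<longleftrightarrow>
     (\<forall>c\<in>\<A>. smooth_on (chart_image c) (a c)) \<and>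
     (\<forall>c\<in>\<A>. \<forall>d\<in>\<A>. \<forall>x\<in>overlap c d. a c x =
        transpose (jacobian (transition c d) (at x)) ** a d (transition c d x)
          ** jacobian (transition c d) (at x)) \<and>
     (\<exists>s\<in>{1, -1}. \<forall>c\<in>\<A>. \<forall>x\<in>chart_image c. \<exists>P :: real^4^4. invertible P \<and>
        transpose P ** a c x ** P = (\<chi> i j. if i = j then (if i = 1 then - s else s) else 0))"

definition one_form :: "'m chart set \<Rightarrow> ('m chart \<Rightarrow> real^4 \<Rightarrow> real^4) \<Rightarrow> bool" where
  "one_form \<A> b \<longleftrightarrow>
     (\<forall>c\<in>\<A>. smooth_on (chart_image c) (b c)) \<and>
     (\<forall>c\<in>\<A>. \<forall>d\<in>\<A>. \<forall>x\<in>overlap c d.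
        b c x = transpose (jacobian (transition c d) (at x)) *v b d (transition c d x))"

definition randers_alpha :: "(real^4 \<Rightarrow> real^4^4) \<Rightarrow> cfun" where
  "randers_alpha a z = sqrt \<bar>\<Sum>\<mu>\<in>UNIV. \<Sum>\<nu>\<in>UNIV. a (fst z) $ \<mu> $ \<nu> * snd z $ \<mu> * snd z $ \<nu>\<bar>"

definition randers_beta :: "(real^4 \<Rightarrow> real^4) \<Rightarrow> cfun" where
  "randers_beta b z = (\<Sum>\<mu>\<in>UNIV. b (fst z) $ \<mu> * snd z $ \<mu>)"

definition randers_metric ::
  "'m topology \<Rightarrow> 'm chart set \<Rightarrow> 'm tvec set \<Rightarrow> ('m tvec \<Rightarrow> real) \<Rightarrow> bool" where
  "randers_metric M \<A> W F \<longleftrightarrow> finsler_metric M \<A> W F \<and>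
     (\<exists>a b. lorentzian_metric \<A> a \<and> one_form \<A> b \<and>
       (\<forall>c\<in>\<A>. \<forall>w\<in>over c W. randers_alpha (a c) (tcoord c w) \<noteq> 0 \<and>
          F w = randers_alpha (a c) (tcoord c w) + randers_beta (b c) (tcoord c w)))"

section \<open>Equations on the whole domain\<close>

definition vacuum_field_equation ::
  "'m topology \<Rightarrow> 'm chart set \<Rightarrow> 'm tvec set \<Rightarrow> ('m tvec \<Rightarrow> real) \<Rightarrow> bool" where
  "vacuum_field_equation M \<A> W F \<longleftrightarrow>
     (\<forall>c\<in>\<A>. \<forall>z\<in>coord_image c W. field_eq_lhs (local_rep M \<A> c F) z = 0)"

definition ricci_tensor_vanishes ::
  "'m topology \<Rightarrow> 'm chart set \<Rightarrow> 'm tvec set \<Rightarrow> ('m tvec \<Rightarrow> real) \<Rightarrow> bool" where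
  "ricci_tensor_vanishes M \<A> W F \<longleftrightarrow>
     (\<forall>c\<in>\<A>. \<forall>z\<in>coord_image c W. \<forall>\<mu> \<nu>. ricci_tensor (local_rep M \<A> c F) \<mu> \<nu> z = 0)"

definition ricci_scalar_vanishes ::
  "'m topology \<Rightarrow> 'm chart set \<Rightarrow> 'm tvec set \<Rightarrow> ('m tvec \<Rightarrow> real) \<Rightarrow> bool" where
  "ricci_scalar_vanishes M \<A> W F \<longleftrightarrow>
     (\<forall>c\<in>\<A>. \<forall>z\<in>coord_image c W. ricci_scalar (local_rep M \<A> c F) z = 0)"

end

theory Submission
  imports Defs
begin

text \<open>
  The Berwald condition makes \<open>Ric(x,y)\<close> a quadratic form in \<open>y\<close>, with a symmetric matrix \<open>r(x)\<close>
  that equals the Ricci tensor; this settles the second equivalence. The rest is algebra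
  in a single fibre. Let \<open>\<epsilon>\<close> be the sign of \<open>A = a(y,y)\<close>, \<open>R = r(y,y)\<close>, \<open>T\<close> the \<open>a\<close>-trace of \<open>r\<close> and
  \<open>S = r(b,y)\<close>, with the index of \<open>b\<close> raised by \<open>a\<close>. With the explicit inverse of the fundamental
  tensor the field equation, multiplied by \<open>F\<close>, reads \<open>P + \<alpha> P' = 0\<close> with the polynomials
  \<open>P = 2 (A (\<beta> T - S) - \<beta> R)\<close> and \<open>P' = (A + \<epsilon> \<beta>\<^sup>2) T - 2 \<epsilon> \<beta> S + (\<epsilon> b\<^sup>2 - 3) R\<close>. Hence
  \<open>P\<^sup>2 = \<epsilon> A P'\<^sup>2\<close> as polynomials, and since \<open>a\<close> is indefinite, \<open>P\<close> and \<open>P'\<close> vanish on the open set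
  where \<open>\<epsilon> A < 0\<close>, hence identically. Taking the \<open>a\<close>-trace of the Hessian of \<open>P\<close> gives
  \<open>\<beta> (3/8 T A - R) = 0\<close>. If \<open>b = 0\<close> then \<open>P' = 0\<close> gives \<open>R = T A / 3\<close>, otherwise \<open>R = 3/8 T A\<close>; either
  way the trace of this relation forces \<open>T = 0\<close>, so \<open>r = 0\<close>.
\<close>

section \<open>Calculus of smooth functions\<close>

text \<open>\<open>frechet_derivative\<close> is chosen through \<open>has_derivative\<close> alone,
  so functions with the same derivatives at \<open>x\<close> get the same choice.\<close>

lemma frechet_derivative_cong_open:
  assumes "open S" "x \<in> S" "\<And>y. y \<in> S \<Longrightarrow> f y = g y"
  shows "frechet_derivative f (at x) = frechet_derivative g (at x)"
proof -
  have "(f has_derivative D) (at x) \<longleftrightarrow> (g has_derivative D) (at x)" for D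
    using assms has_derivative_transform_within_open[of _ D x UNIV S] by metis
  then show ?thesis unfolding frechet_derivative_def by simp
qed

lemma differentiable_cong_open:
  assumes "open S" "x \<in> S" "\<And>y. y \<in> S \<Longrightarrow> f y = g y"
  shows "f differentiable (at x) \<longleftrightarrow> g differentiable (at x)"
  unfolding differentiable_def
  using assms has_derivative_transform_within_open[of _ _ x UNIV S] by metis

lemma ck_on_cong:
  assumes "open S" "\<And>y. y \<in> S \<Longrightarrow> f y = g y"
  shows "ck_on k S f \<longleftrightarrow> ck_on k S g"
  using assms(2)
proof (induction k arbitrary: f g)
  case 0
  then show ?case by (simp cong: continuous_on_cong)
next
  case (Suc k)
  have "ck_on k S (\<lambda>x. frechet_derivative f (at x) v) \<longleftrightarrow> ck_on k S (\<lambda>x. frechet_derivative g (at x) v)" for v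
    by (rule Suc.IH) (simp add: frechet_derivative_cong_open[OF assms(1) _ Suc.prems])
  then show ?case
    using differentiable_cong_open[OF assms(1) _ Suc.prems] by simp
qed

text \<open>Level \<open>Suc k\<close> does not refer to level \<open>k\<close> of \<open>f\<close>
  itself; the induction descends to level 0, where differentiability gives continuity.\<close>

lemma ck_on_SucD: "ck_on (Suc k) S f \<Longrightarrow> ck_on k S f"
proof (induction k arbitrary: f)
  case 0
  then show ?case
    by (auto intro!: continuous_at_imp_continuous_on differentiable_imp_continuous_within)
next
  case (Suc k)
  from Suc.prems have "\<forall>x\<in>S. f differentiable (at x)"
    and "\<And>v. ck_on (Suc k) S (\<lambda>x. frechet_derivative f (at x) v)" by simp_all
  then show ?case using Suc.IH by simp
qed

lemma smooth_on_differentiable: "smooth_on S f \<Longrightarrow> x \<in> S \<Longrightarrow> f differentiable (at x)"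
  unfolding smooth_on_def by (metis ck_on.simps(2))

lemma smooth_on_frechet_derivative:
  "smooth_on S f \<Longrightarrow> smooth_on S (\<lambda>x. frechet_derivative f (at x) v)"
  unfolding smooth_on_def by (metis ck_on.simps(2))

lemma smooth_on_cong:
  assumes "open S" "\<And>y. y \<in> S \<Longrightarrow> f y = g y"
  shows "smooth_on S f \<longleftrightarrow> smooth_on S g"
  unfolding smooth_on_def using ck_on_cong[OF assms] by simp

lemma ck_on_const: "ck_on k S (\<lambda>x. c)"
  by (induction k arbitrary: c) auto

lemma smooth_on_const: "smooth_on S (\<lambda>x. c)"
  by (simp add: smooth_on_def ck_on_const)

text \<open>The derivative at every point is the map itself, hence constant in the base point, so a
  case distinction on \<open>k\<close> suffices.\<close>

lemma smooth_on_bounded_linear: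
  assumes "bounded_linear f"
  shows "smooth_on S f"
  unfolding smooth_on_def
proof
  fix k
  have "frechet_derivative f (at x) v = f v" for x v
    using bounded_linear_imp_has_derivative[OF assms, of "at x"] frechet_derivative_at by metis
  then show "ck_on k S f"
    using assms by (cases k) (auto simp: ck_on_const bounded_linear_imp_differentiable
        intro: linear_continuous_on)
qed

lemma ck_on_add:
  assumes "open S" "ck_on k S f" "ck_on k S g"
  shows "ck_on k S (\<lambda>x. f x + g x)"
  using assms(2,3)
proof (induction k arbitrary: f g)
  case 0
  then show ?case by (auto intro: continuous_intros)
next
  case (Suc k)
  have "ck_on k S (\<lambda>x. frechet_derivative (\<lambda>x. f x + g x) (at x) v)" for v
  proof -
    have "ck_on k S (\<lambda>x. frechet_derivative f (at x) v + frechet_derivative g (at x) v)"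
      using Suc by simp
    moreover have "frechet_derivative f (at x) v + frechet_derivative g (at x) v =
        frechet_derivative (\<lambda>x. f x + g x) (at x) v" if "x \<in> S" for x
    proof -
      have "(f has_derivative frechet_derivative f (at x)) (at x)"
        "(g has_derivative frechet_derivative g (at x)) (at x)"
        using Suc.prems that by (simp_all add: frechet_derivative_works[THEN iffD1])
      from frechet_derivative_at[OF has_derivative_add[OF this]] show ?thesis
        by (metis)
    qed
    ultimately show ?thesis using ck_on_cong[OF assms(1)] by (metis (no_types, lifting))
  qed
  then show ?case using Suc.prems by (simp add: differentiable_add)
qed

text \<open>Leibniz's rule: the derivative is a sum of products in which the undifferentiated factor
  is lowered by one order with \<open>ck_on_SucD\<close>, so the induction hypothesis applies to
  each product.\<close>

lemma ck_on_mult: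
  fixes f g :: "'a::real_normed_vector \<Rightarrow> real"
  assumes "open S" "ck_on k S f" "ck_on k S g"
  shows "ck_on k S (\<lambda>x. f x * g x)"
  using assms(2,3)
proof (induction k arbitrary: f g)
  case 0
  then show ?case by (auto intro: continuous_intros)
next
  case (Suc k)
  have "ck_on k S (\<lambda>x. frechet_derivative (\<lambda>x. f x * g x) (at x) v)" for v
  proof -
    have "ck_on k S (\<lambda>x. f x * frechet_derivative g (at x) v + frechet_derivative f (at x) v * g x)"
      using Suc.prems by (intro ck_on_add assms(1) Suc.IH) (simp_all add: ck_on_SucD del: ck_on.simps(2), simp_all)
    moreover have "f x * frechet_derivative g (at x) v + frechet_derivative f (at x) v * g x =
        frechet_derivative (\<lambda>x. f x * g x) (at x) v" if "x \<in> S" for x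
    proof -
      have "(f has_derivative frechet_derivative f (at x)) (at x)"
        "(g has_derivative frechet_derivative g (at x)) (at x)"
        using Suc.prems that by (simp_all add: frechet_derivative_works[THEN iffD1])
      from frechet_derivative_at[OF has_derivative_mult[OF this]] show ?thesis
        by (metis)
    qed
    ultimately show ?thesis using ck_on_cong[OF assms(1)] by (metis (no_types, lifting))
  qed
  then show ?case using Suc.prems by (simp add: differentiable_mult)
qed

lemma ck_on_inverse:
  fixes f :: "'a::real_normed_vector \<Rightarrow> real"
  assumes "open S" "ck_on k S f" "\<And>x. x \<in> S \<Longrightarrow> f x \<noteq> 0"
  shows "ck_on k S (\<lambda>x. inverse (f x))"
  using assms(2)
proof (induction k)
  case 0
  then show ?case using assms(3) by (auto intro: continuous_intros)
next
  case (Suc k)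
  \<comment> \<open>The derivative of \<open>1/f\<close> contains \<open>1/f\<close> again; its
    regularity one order lower is the induction hypothesis.\<close>
  note IH = Suc.IH[OF ck_on_SucD[OF Suc.prems]]
  have D: "((\<lambda>x. inverse (f x)) has_derivative
      (\<lambda>v. - (inverse (f x) * frechet_derivative f (at x) v * inverse (f x)))) (at x)"
    if "x \<in> S" for x
    by (rule Deriv.has_derivative_inverse)
      (use Suc.prems that assms(3) in \<open>simp_all add: frechet_derivative_works[THEN iffD1]\<close>)
  have "ck_on k S (\<lambda>x. frechet_derivative (\<lambda>x. inverse (f x)) (at x) v)" for v
  proof -
    have "ck_on k S (\<lambda>x. - 1 * (inverse (f x) * frechet_derivative f (at x) v * inverse (f x)))"
      using Suc.prems by (intro ck_on_mult assms(1) IH ck_on_const) simp_all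
    moreover have "- 1 * (inverse (f x) * frechet_derivative f (at x) v * inverse (f x)) =
        frechet_derivative (\<lambda>x. inverse (f x)) (at x) v" if "x \<in> S" for x
      using frechet_derivative_at[OF D[OF that]] by (metis mult_minus1)
    ultimately show ?thesis using ck_on_cong[OF assms(1)] by (metis (no_types, lifting))
  qed
  then show ?case using D by (auto simp: differentiable_def)
qed

section \<open>Matrix inverses and their smooth dependence on parameters\<close>

lemma matrix_inv_mult:
  fixes A :: "real^'n^'n"
  assumes "invertible A"
  shows "A ** matrix_inv A = mat 1" "matrix_inv A ** A = mat 1"
  using someI_ex[OF assms[unfolded invertible_def]] unfolding matrix_inv_def by auto

lemma matrix_inv_eqI:
  fixes A :: "real^'n^'n"
  assumes "A ** B = mat 1"
  shows "matrix_inv A = B"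
proof -
  have "invertible A"
    using assms invertible_right_inverse by blast
  then show ?thesis
    using matrix_inv_mult(2) assms by (metis matrix_mul_assoc matrix_mul_lid matrix_mul_rid)
qed

context
  fixes S :: "'a::real_normed_vector set"
  assumes opS: "open S"
begin

lemma smooth_on_add: "smooth_on S f \<Longrightarrow> smooth_on S g \<Longrightarrow> smooth_on S (\<lambda>x. f x + g x)"
  unfolding smooth_on_def by (blast intro: ck_on_add opS)

lemma smooth_on_mult:
  fixes f g :: "'a \<Rightarrow> real"
  shows "smooth_on S f \<Longrightarrow> smooth_on S g \<Longrightarrow> smooth_on S (\<lambda>x. f x * g x)"
  using ck_on_mult[OF opS] by (simp add: smooth_on_def)

lemma smooth_on_diff:
  fixes f g :: "'a \<Rightarrow> real"
  shows "smooth_on S f \<Longrightarrow> smooth_on S g \<Longrightarrow> smooth_on S (\<lambda>x. f x - g x)"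
  using smooth_on_add[OF _ smooth_on_mult[OF smooth_on_const[where c = "-1"]], of f g] by simp

lemma smooth_on_divide:
  fixes f g :: "'a \<Rightarrow> real"
  shows "smooth_on S f \<Longrightarrow> smooth_on S g \<Longrightarrow> (\<And>x. x \<in> S \<Longrightarrow> g x \<noteq> 0) \<Longrightarrow>
    smooth_on S (\<lambda>x. f x / g x)"
  using ck_on_mult[OF opS] ck_on_inverse[OF opS] by (simp add: smooth_on_def divide_inverse)

lemma smooth_on_sum:
  fixes f :: "'i \<Rightarrow> 'a \<Rightarrow> real"
  assumes "\<And>i. i \<in> I \<Longrightarrow> smooth_on S (f i)"
  shows "smooth_on S (\<lambda>x. \<Sum>i\<in>I. f i x)"
  using assms
  by (induction I rule: infinite_finite_induct) (auto intro: smooth_on_const smooth_on_add)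

lemma smooth_on_prod:
  fixes f :: "'i \<Rightarrow> 'a \<Rightarrow> real"
  assumes "\<And>i. i \<in> I \<Longrightarrow> smooth_on S (f i)"
  shows "smooth_on S (\<lambda>x. \<Prod>i\<in>I. f i x)"
  using assms
  by (induction I rule: infinite_finite_induct) (auto intro: smooth_on_const smooth_on_mult)

lemma smooth_on_det:
  fixes A :: "'a \<Rightarrow> real^'n^'n"
  assumes "\<And>i j. smooth_on S (\<lambda>x. A x $ i $ j)"
  shows "smooth_on S (\<lambda>x. det (A x))"
  unfolding det_def
  by (intro smooth_on_sum smooth_on_mult smooth_on_const smooth_on_prod assms)

text \<open>By Cramer's rule each entry of the inverse is a quotient of two determinants, and
  determinants are polynomials in the entries.\<close>

lemma smooth_on_matrix_inv:
  fixes A :: "'a \<Rightarrow> real^'n^'n"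
  assumes A: "\<And>i j. smooth_on S (\<lambda>x. A x $ i $ j)" and det: "\<And>x. x \<in> S \<Longrightarrow> det (A x) \<noteq> 0"
  shows "smooth_on S (\<lambda>x. matrix_inv (A x) $ i $ j)"
proof -
  \<comment> \<open>\<open>A x\<close> with its column \<open>i\<close> replaced by the basis vector
    \<open>j\<close>.\<close>
  let ?C = "\<lambda>x. (\<chi> k l. if l = i then axis j 1 $ k else A x $ k $ l) :: real^'n^'n"
  have "matrix_inv (A x) $ i $ j = det (?C x) / det (A x)" if "x \<in> S" for x
  proof -
    have "A x ** matrix_inv (A x) = mat 1"
      using det[OF that] by (simp add: invertible_det_nz matrix_inv_mult)
    then have "A x *v (matrix_inv (A x) *v axis j 1) = axis j 1"
      by (simp add: matrix_vector_mul_assoc)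
    then have "matrix_inv (A x) *v axis j 1 =
        (\<chi> k. det (\<chi> m l. if l = k then axis j 1 $ m else A x $ m $ l) / det (A x))"
      using cramer[OF det[OF that]] by blast
    then show ?thesis
      by (metis (no_types, lifting) column_def matrix_vector_mul_component matrix_vector_mult_basis vec_lambda_beta)
  qed
  moreover have "smooth_on S (\<lambda>x. det (?C x) / det (A x))"
  proof (intro smooth_on_divide smooth_on_det det)
    show "smooth_on S (\<lambda>x. ?C x $ k $ l)" for k l
      by (cases "l = i") (auto intro: smooth_on_const A)
  qed (auto intro: A)
  ultimately show ?thesis using smooth_on_cong[OF opS] by (metis (no_types, lifting))
qed

end

section \<open>The Ricci tensor of a Berwald metric\<close>

text \<open>Links the one-variable \<open>deriv\<close> in \<open>dx\<close> and \<open>dy\<close>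
  to the Frechet derivative, on which \<open>smooth_on\<close> is built.\<close>

lemma has_derivative_line:
  fixes f :: "'a::real_normed_vector \<Rightarrow> real"
  assumes "(f has_derivative f') (at z)"
  shows "((\<lambda>t. f (z + t *\<^sub>R v)) has_field_derivative f' v) (at 0)"
proof -
  have "((\<lambda>t. f (z + t *\<^sub>R v)) has_derivative (\<lambda>t. f' (t *\<^sub>R v))) (at 0)"
    by (rule has_derivative_compose[where g = f]) (use assms in \<open>auto intro!: derivative_eq_intros\<close>)
  moreover have "f' (t *\<^sub>R v) = f' v * t" for t
    using linear_scale[OF has_derivative_linear[OF assms]] by simp
  ultimately show ?thesis
    by (simp add: has_field_derivative_def)
qed

lemma dx_line: "dx \<mu> f z = deriv (\<lambda>t. f (z + t *\<^sub>R (axis \<mu> 1, 0))) 0"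
  by (cases z) (simp add: dx_def)

lemma dy_line: "dy \<mu> f z = deriv (\<lambda>t. f (z + t *\<^sub>R (0, axis \<mu> 1))) 0"
  by (cases z) (simp add: dy_def)

lemma eventually_line_in_open:
  fixes z v :: "'a::real_normed_vector"
  assumes "open D" "z \<in> D"
  shows "\<forall>\<^sub>F t in nhds (0::real). z + t *\<^sub>R v \<in> D"
proof -
  have "open ((\<lambda>t::real. z + t *\<^sub>R v) -` D)"
    by (intro open_vimage assms continuous_intros)
  then show ?thesis
    unfolding eventually_nhds using assms(2) by (intro exI[of _ "(\<lambda>t. z + t *\<^sub>R v) -` D"]) simp
qed

lemma deriv_line_cong:
  fixes f g :: "'a::real_normed_vector \<Rightarrow> real"
  assumes "open D" "z \<in> D" "\<And>w. w \<in> D \<Longrightarrow> f w = g w"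
  shows "deriv (\<lambda>t. f (z + t *\<^sub>R v)) 0 = deriv (\<lambda>t. g (z + t *\<^sub>R v)) 0"
  by (rule deriv_cong_ev[OF eventually_mono[OF eventually_line_in_open[OF assms(1,2), of v]]])
    (simp_all add: assms(3))

lemma dx_cong:
  assumes "open D" "z \<in> D" "\<And>w. w \<in> D \<Longrightarrow> f w = g w"
  shows "dx \<mu> f z = dx \<mu> g z"
  unfolding dx_line by (rule deriv_line_cong[OF assms])

lemma dy_cong:
  assumes "open D" "z \<in> D" "\<And>w. w \<in> D \<Longrightarrow> f w = g w"
  shows "dy \<mu> f z = dy \<mu> g z"
  unfolding dy_line by (rule deriv_line_cong[OF assms])

lemma dx_frechet: "f differentiable (at z) \<Longrightarrow> dx \<mu> f z = frechet_derivative f (at z) (axis \<mu> 1, 0)"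
  unfolding dx_line frechet_derivative_works by (rule DERIV_imp_deriv[OF has_derivative_line])

lemma dy_frechet: "f differentiable (at z) \<Longrightarrow> dy \<mu> f z = frechet_derivative f (at z) (0, axis \<mu> 1)"
  unfolding dy_line frechet_derivative_works by (rule DERIV_imp_deriv[OF has_derivative_line])

lemma smooth_on_dx:
  assumes "open D" "smooth_on D f" shows "smooth_on D (dx \<mu> f)"
  by (subst smooth_on_cong[OF assms(1) dx_frechet[OF smooth_on_differentiable[OF assms(2)]]])
    (simp_all add: smooth_on_frechet_derivative assms)

lemma smooth_on_dy:
  assumes "open D" "smooth_on D f" shows "smooth_on D (dy \<mu> f)"
  by (subst smooth_on_cong[OF assms(1) dy_frechet[OF smooth_on_differentiable[OF assms(2)]]])
    (simp_all add: smooth_on_frechet_derivative assms)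

lemma smooth_on_lagr: "open D \<Longrightarrow> smooth_on D f \<Longrightarrow> smooth_on D (lagr f)"
  unfolding lagr_def power2_eq_square by (rule smooth_on_mult)

lemma smooth_on_snd_component: "smooth_on D (\<lambda>z. snd z $ i)"
  by (intro smooth_on_bounded_linear bounded_linear_compose[OF bounded_linear_vec_nth bounded_linear_snd])

text \<open>The connection arises from \<open>f\<close> by partial derivatives, ring operations and
  inversion of the nondegenerate fundamental tensor, all of which preserve smoothness.\<close>

lemma smooth_on_nl_conn:
  assumes D: "open D" and f: "smooth_on D f"
    and det: "\<And>z. z \<in> D \<Longrightarrow> det (fund_tensor f z) \<noteq> 0"
  shows "smooth_on D (nl_conn f \<rho> \<mu>)"
proof -
  have "smooth_on D (\<lambda>z. fund_tensor f z $ i $ j)" for i j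
    unfolding fund_tensor_def
    by (simp, intro smooth_on_divide D smooth_on_dy smooth_on_lagr f smooth_on_const) simp
  then have "smooth_on D (\<lambda>z. fund_tensor_inv f z $ i $ j)" for i j
    unfolding fund_tensor_inv_def by (intro smooth_on_matrix_inv D det)
  then show ?thesis
    unfolding nl_conn_def
    by (intro smooth_on_mult smooth_on_const smooth_on_dy smooth_on_sum smooth_on_diff smooth_on_dx
        smooth_on_lagr smooth_on_snd_component D f)
qed

lemma DERIV_sum_mult_component:
  "((\<lambda>t. \<Sum>\<nu>\<in>UNIV. c \<nu> * (y + t *\<^sub>R axis \<rho> 1) $ \<nu>) has_field_derivative c \<rho>) (at (t::real))"
  for c :: "'n::finite \<Rightarrow> real"
proof -
  have "((\<lambda>t. \<Sum>\<nu>\<in>UNIV. c \<nu> * (y + t *\<^sub>R axis \<rho> 1) $ \<nu>) has_field_derivative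
      (\<Sum>\<nu>\<in>UNIV. c \<nu> * axis \<rho> 1 $ \<nu>)) (at t)"
    by (auto intro!: derivative_eq_intros simp: mult.commute)
  also have "(\<Sum>\<nu>\<in>UNIV. c \<nu> * axis \<rho> 1 $ \<nu>) = c \<rho>"
    by (simp add: axis_def if_distrib cong: if_cong)
  finally show ?thesis .
qed

section \<open>Curvature of a connection that is linear in the fibres\<close>

context
  fixes D :: "((real^4) \<times> (real^4)) set" and f :: cfun and \<Gamma> :: "4 \<Rightarrow> 4 \<Rightarrow> 4 \<Rightarrow> real^4 \<Rightarrow> real"
  assumes D: "open D" and f: "smooth_on D f"
    and det: "\<And>z. z \<in> D \<Longrightarrow> det (fund_tensor f z) \<noteq> 0"
    and conn: "\<And>z \<rho> \<mu>. z \<in> D \<Longrightarrow> nl_conn f \<rho> \<mu> z = (\<Sum>\<nu>\<in>UNIV. \<Gamma> \<rho> \<mu> \<nu> (fst z) * snd z $ \<nu>)"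
begin

lemma dy_nl_conn:
  assumes "z \<in> D" shows "dy \<sigma> (nl_conn f \<rho> \<mu>) z = \<Gamma> \<rho> \<mu> \<sigma> (fst z)"
proof -
  have "dy \<sigma> (nl_conn f \<rho> \<mu>) z = dy \<sigma> (\<lambda>z. \<Sum>\<nu>\<in>UNIV. \<Gamma> \<rho> \<mu> \<nu> (fst z) * snd z $ \<nu>) z"
    by (rule dy_cong[OF D assms conn])
  also have "\<dots> = \<Gamma> \<rho> \<mu> \<sigma> (fst z)"
    unfolding dy_def fst_conv snd_conv
    by (rule DERIV_imp_deriv[OF DERIV_sum_mult_component])
  finally show ?thesis .
qed

text \<open>The \<open>\<Gamma>\<close> of a Berwald metric are not assumed differentiable; as fibre derivatives of the
  nonlinear connection they inherit its smoothness.\<close>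

lemma DERIV_berwald_coeff:
  assumes "z \<in> D"
  shows "((\<lambda>t. \<Gamma> \<rho> \<mu> \<nu> (fst z + t *\<^sub>R axis \<kappa> 1)) has_field_derivative
    deriv (\<lambda>t. \<Gamma> \<rho> \<mu> \<nu> (fst z + t *\<^sub>R axis \<kappa> 1)) 0) (at 0)"
proof -
  let ?N = "dy \<nu> (nl_conn f \<rho> \<mu>)" and ?v = "(axis \<kappa> 1, 0) :: (real^4) \<times> (real^4)"
  have "?N differentiable (at z)"
    by (rule smooth_on_differentiable[OF smooth_on_dy[OF D smooth_on_nl_conn[OF D f det]] assms])
  then obtain N' where "((\<lambda>t. ?N (z + t *\<^sub>R ?v)) has_field_derivative N') (at 0)"
    using has_derivative_line unfolding differentiable_def by blast
  \<comment> \<open>For small \<open>t\<close> the line stays in the open set \<open>D\<close>,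
    where the coefficient is a fibre derivative of the connection.\<close>
  moreover have "\<forall>\<^sub>F t in nhds 0. \<Gamma> \<rho> \<mu> \<nu> (fst z + t *\<^sub>R axis \<kappa> 1) = ?N (z + t *\<^sub>R ?v)"
    by (rule eventually_mono[OF eventually_line_in_open[OF D assms, of ?v]]) (simp add: dy_nl_conn)
  ultimately have "((\<lambda>t. \<Gamma> \<rho> \<mu> \<nu> (fst z + t *\<^sub>R axis \<kappa> 1)) has_field_derivative N') (at 0)"
    by (subst DERIV_cong_ev[OF refl _ refl])
  then show ?thesis by (simp add: DERIV_imp_deriv)
qed

lemma dx_nl_conn:
  assumes "z \<in> D"
  shows "dx \<kappa> (nl_conn f \<rho> \<mu>) z =
    (\<Sum>\<nu>\<in>UNIV. deriv (\<lambda>t. \<Gamma> \<rho> \<mu> \<nu> (fst z + t *\<^sub>R axis \<kappa> 1)) 0 * snd z $ \<nu>)"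
proof -
  have "dx \<kappa> (nl_conn f \<rho> \<mu>) z = dx \<kappa> (\<lambda>z. \<Sum>\<nu>\<in>UNIV. \<Gamma> \<rho> \<mu> \<nu> (fst z) * snd z $ \<nu>) z"
    by (rule dx_cong[OF D assms conn])
  also have "\<dots> = (\<Sum>\<nu>\<in>UNIV. deriv (\<lambda>t. \<Gamma> \<rho> \<mu> \<nu> (fst z + t *\<^sub>R axis \<kappa> 1)) 0 * snd z $ \<nu>)"
    unfolding dx_def fst_conv snd_conv
    by (rule DERIV_imp_deriv) (intro DERIV_sum DERIV_cmult_right DERIV_berwald_coeff assms)
  finally show ?thesis .
qed

text \<open>The curvature is that of the affine connection \<Gamma>, hence linear in y; contracting
  it once more with y gives a quadratic form whose coefficients depend on x only.\<close>

lemma ricci_scalar_quadratic: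
  obtains Q :: "real^4 \<Rightarrow> real^4^4"
  where "\<And>x. transpose (Q x) = Q x" "\<And>z. z \<in> D \<Longrightarrow> ricci_scalar f z = snd z \<bullet> (Q (fst z) *v snd z)"
proof -
  \<comment> \<open>The contracted curvature of \<Gamma>, before symmetrisation.\<close>
  define q where "q x \<nu> \<kappa> = (\<Sum>\<mu>\<in>UNIV.
      (deriv (\<lambda>t. \<Gamma> \<mu> \<nu> \<kappa> (x + t *\<^sub>R axis \<mu> 1)) 0 - (\<Sum>\<rho>\<in>UNIV. \<Gamma> \<rho> \<mu> \<kappa> x * \<Gamma> \<mu> \<nu> \<rho> x)) -
      (deriv (\<lambda>t. \<Gamma> \<mu> \<mu> \<kappa> (x + t *\<^sub>R axis \<nu> 1)) 0 - (\<Sum>\<rho>\<in>UNIV. \<Gamma> \<rho> \<nu> \<kappa> x * \<Gamma> \<mu> \<mu> \<rho> x)))"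
    for x \<nu> \<kappa>
  \<comment> \<open>No symmetry of \<open>q\<close> is available, but its quadratic form only sees
    the symmetric part.\<close>
  define Q where "Q x = (\<chi> \<nu> \<kappa>. (q x \<nu> \<kappa> + q x \<kappa> \<nu>) / 2)" for x
  have hor: "hor f \<mu> (nl_conn f \<sigma> \<nu>) z = (\<Sum>\<kappa>\<in>UNIV.
      (deriv (\<lambda>t. \<Gamma> \<sigma> \<nu> \<kappa> (fst z + t *\<^sub>R axis \<mu> 1)) 0 - (\<Sum>\<rho>\<in>UNIV. \<Gamma> \<rho> \<mu> \<kappa> (fst z) * \<Gamma> \<sigma> \<nu> \<rho> (fst z)))
      * snd z $ \<kappa>)" if "z \<in> D" for z \<mu> \<sigma> \<nu>
  proof -
    have "(\<Sum>\<rho>\<in>UNIV. nl_conn f \<rho> \<mu> z * dy \<rho> (nl_conn f \<sigma> \<nu>) z) =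
        (\<Sum>\<rho>\<in>UNIV. \<Sum>\<kappa>\<in>UNIV. \<Gamma> \<rho> \<mu> \<kappa> (fst z) * \<Gamma> \<sigma> \<nu> \<rho> (fst z) * snd z $ \<kappa>)"
      by (simp add: conn dy_nl_conn that sum_distrib_right sum_distrib_left mult_ac)
    also have "\<dots> = (\<Sum>\<kappa>\<in>UNIV. (\<Sum>\<rho>\<in>UNIV. \<Gamma> \<rho> \<mu> \<kappa> (fst z) * \<Gamma> \<sigma> \<nu> \<rho> (fst z)) * snd z $ \<kappa>)"
      by (subst sum.swap) (simp add: sum_distrib_right)
    finally show ?thesis
      by (simp add: hor_def dx_nl_conn that left_diff_distrib sum_subtractf)
  qed
  have "ricci_scalar f z = snd z \<bullet> (Q (fst z) *v snd z)" if z: "z \<in> D" for z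
  proof -
    let ?y = "snd z"
    have "ricci_scalar f z = (\<Sum>\<nu>\<in>UNIV. \<Sum>\<mu>\<in>UNIV. nl_curv f \<mu> \<mu> \<nu> z * ?y $ \<nu>)"
      unfolding ricci_scalar_def by (rule sum.swap)
    also have "\<dots> = (\<Sum>\<nu>\<in>UNIV. \<Sum>\<kappa>\<in>UNIV. q (fst z) \<nu> \<kappa> * ?y $ \<kappa> * ?y $ \<nu>)"
    proof (rule sum.cong[OF refl])
      fix \<nu>
      have "(\<Sum>\<mu>\<in>UNIV. nl_curv f \<mu> \<mu> \<nu> z) = (\<Sum>\<kappa>\<in>UNIV. q (fst z) \<nu> \<kappa> * ?y $ \<kappa>)"
        unfolding nl_curv_def hor[OF z] q_def sum_subtractf[symmetric] left_diff_distrib[symmetric]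
          sum_distrib_right by (rule sum.swap)
      then show "(\<Sum>\<mu>\<in>UNIV. nl_curv f \<mu> \<mu> \<nu> z * ?y $ \<nu>) =
          (\<Sum>\<kappa>\<in>UNIV. q (fst z) \<nu> \<kappa> * ?y $ \<kappa> * ?y $ \<nu>)"
        by (simp add: sum_distrib_right[symmetric])
    qed
    finally have 1: "ricci_scalar f z = (\<Sum>\<nu>\<in>UNIV. \<Sum>\<kappa>\<in>UNIV. q (fst z) \<nu> \<kappa> * ?y $ \<kappa> * ?y $ \<nu>)" .
    \<comment> \<open>Exchanging the two summation indices transposes \<open>q\<close>; the mean of
      both expressions is the form of \<open>Q\<close>.\<close>
    then have 2: "ricci_scalar f z = (\<Sum>\<nu>\<in>UNIV. \<Sum>\<kappa>\<in>UNIV. q (fst z) \<kappa> \<nu> * ?y $ \<kappa> * ?y $ \<nu>)"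
      by (subst sum.swap) (simp add: mult_ac)
    have "?y \<bullet> (Q (fst z) *v ?y) =
        (\<Sum>\<nu>\<in>UNIV. \<Sum>\<kappa>\<in>UNIV. (q (fst z) \<nu> \<kappa> * ?y $ \<kappa> * ?y $ \<nu> + q (fst z) \<kappa> \<nu> * ?y $ \<kappa> * ?y $ \<nu>) / 2)"
      by (auto simp: inner_vec_def matrix_vector_mult_def Q_def sum_distrib_left add_divide_distrib
          distrib_left distrib_right mult_ac intro!: sum.cong)
    also have "\<dots> = ricci_scalar f z"
      unfolding sum_divide_distrib[symmetric] sum.distrib 1[symmetric] 2[symmetric] by simp
    finally show ?thesis ..
  qed
  moreover have "transpose (Q x) = Q x" for x
    by (simp add: Q_def transpose_def vec_eq_iff add.commute)
  ultimately show thesis by (intro that[of Q])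
qed

end

lemma DERIV_quadratic_form:
  fixes Q :: "real^'n^'n"
  assumes "transpose Q = Q"
  shows "((\<lambda>t. (y + t *\<^sub>R v) \<bullet> (Q *v (y + t *\<^sub>R v))) has_field_derivative 2 * (v \<bullet> (Q *v y))) (at 0)"
proof -
  have "y \<bullet> (Q *v v) = v \<bullet> (Q *v y)"
    using assms by (metis dot_lmul_matrix inner_commute transpose_matrix_vector)
  then have "(y + t *\<^sub>R v) \<bullet> (Q *v (y + t *\<^sub>R v)) =
      y \<bullet> (Q *v y) + t * (2 * (v \<bullet> (Q *v y))) + t\<^sup>2 * (v \<bullet> (Q *v v))" for t
    by (simp only: matrix_vector_right_distrib matrix_vector_mult_scaleR inner_add_left inner_add_right
        inner_scaleR_left inner_scaleR_right power2_eq_square)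
      (simp only: algebra_simps)
  then show ?thesis by (auto intro!: derivative_eq_intros)
qed

text \<open>Half the Hessian of the quadratic form of a symmetric matrix is that matrix, so the
  Ricci tensor is constant along each fibre.\<close>

lemma ricci_tensor_quadratic:
  assumes D: "open D" and Q: "\<And>x. transpose (Q x) = Q x"
    and ric: "\<And>z. z \<in> D \<Longrightarrow> ricci_scalar f z = snd z \<bullet> (Q (fst z) *v snd z)" and z: "z \<in> D"
  shows "ricci_tensor f \<mu> \<nu> z = Q (fst z) $ \<mu> $ \<nu>"
proof -
  \<comment> \<open>Stated at every point of \<open>D\<close>, since it is differentiated a second
    time.\<close>
  have 1: "dy \<nu> (ricci_scalar f) z = (\<Sum>\<kappa>\<in>UNIV. (2 * Q (fst z) $ \<nu> $ \<kappa>) * snd z $ \<kappa>)" if "z \<in> D" for z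
  proof -
    have "dy \<nu> (ricci_scalar f) z = dy \<nu> (\<lambda>z. snd z \<bullet> (Q (fst z) *v snd z)) z"
      by (rule dy_cong[OF D that ric])
    also have "\<dots> = 2 * (axis \<nu> 1 \<bullet> (Q (fst z) *v snd z))"
      unfolding dy_def fst_conv snd_conv by (rule DERIV_imp_deriv[OF DERIV_quadratic_form[OF Q]])
    finally show ?thesis
      by (simp add: inner_axis' matrix_vector_mult_def sum_distrib_left mult.assoc)
  qed
  have "dy \<mu> (dy \<nu> (ricci_scalar f)) z = dy \<mu> (\<lambda>z. \<Sum>\<kappa>\<in>UNIV. (2 * Q (fst z) $ \<nu> $ \<kappa>) * snd z $ \<kappa>) z"
    by (rule dy_cong[OF D z 1])
  also have "\<dots> = 2 * Q (fst z) $ \<nu> $ \<mu>"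
    unfolding dy_def fst_conv snd_conv by (rule DERIV_imp_deriv[OF DERIV_sum_mult_component])
  finally show ?thesis
    using arg_cong[OF Q, of "\<lambda>B. B $ \<mu> $ \<nu>" "fst z"] by (simp add: ricci_tensor_def transpose_def)
qed

section \<open>Quadratic forms and polynomial functions\<close>

definition outer :: "real^'n \<Rightarrow> real^'m \<Rightarrow> real^'m^'n" where
  "outer u v = (\<chi> i j. u $ i * v $ j)"

lemma outer_mult_vector: "outer u v *v x = (v \<bullet> x) *\<^sub>R u"
  by (simp add: outer_def matrix_vector_mult_def vec_eq_iff inner_vec_def sum_distrib_left mult_ac)

text \<open>The inner product of matrices sums the products of equal entries. So
  \<open>C \<bullet> r\<close> is the full contraction of C with r, the trace of r when C is the
  inverse metric, and contractions with vectors become inner products with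
  \<open>outer\<close>.\<close>

lemma inner_outer: "outer u v \<bullet> B = u \<bullet> (B *v v)"
  by (simp add: outer_def matrix_vector_mult_def inner_vec_def sum_distrib_left mult_ac)

lemma inner_symmetric_matrix:
  fixes B :: "real^'n^'n"
  assumes "transpose B = B"
  shows "x \<bullet> (B *v y) = (B *v x) \<bullet> y"
  using assms by (metis dot_lmul_matrix transpose_matrix_vector)

text \<open>The transpose of \<open>C\<close> is an inverse of \<open>B\<close> too, and inverses
  are unique.\<close>

lemma symmetric_inverse:
  fixes B C :: "real^'n^'n"
  assumes B: "transpose B = B" and inv: "B ** C = mat 1"
  shows "transpose C = C"
  using matrix_inv_eqI[OF inv] matrix_inv_eqI[of B "transpose C"] B inv
  by (metis matrix_left_right_inverse matrix_transpose_mul transpose_mat)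

lemma inner_matrix_symmetric_inverse:
  fixes B C :: "real^'n^'n"
  assumes "transpose B = B" "B ** C = mat 1"
  shows "C \<bullet> B = real CARD('n)"
proof -
  have "(\<Sum>j\<in>UNIV. C $ i $ j * B $ i $ j) = (B ** C) $ i $ i" for i
  proof -
    have "(C ** B) $ i $ i = (\<Sum>j\<in>UNIV. C $ i $ j * B $ j $ i)"
      by (simp add: matrix_matrix_mult_def)
    moreover have "B $ j $ i = B $ i $ j" for j
      using arg_cong[OF assms(1), of "\<lambda>M. M $ i $ j"] by (simp add: transpose_def)
    moreover have "C ** B = mat 1"
      using assms(2) by (simp add: matrix_left_right_inverse)
    ultimately show ?thesis using assms(2) by simp
  qed
  then show ?thesis using assms(2) by (simp add: inner_vec_def mat_def)
qed

text \<open>Polarisation recovers the bilinear form from its values on the diagonal.\<close>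

lemma symmetric_matrix_zero_if_quadratic_form_zero:
  fixes B :: "real^'n^'n"
  assumes "transpose B = B" "\<And>y. y \<bullet> (B *v y) = 0"
  shows "B = 0"
proof -
  have "x \<bullet> (B *v y) = 0" for x y
  proof -
    have "(x + y) \<bullet> (B *v (x + y)) = x \<bullet> (B *v x) + 2 * (x \<bullet> (B *v y)) + y \<bullet> (B *v y)"
      using inner_symmetric_matrix[OF assms(1), of y x]
      by (simp add: matrix_vector_right_distrib inner_add_left inner_add_right inner_commute)
    then show ?thesis using assms(2) by simp
  qed
  then have "B *v y = 0" for y
    by (metis inner_eq_zero_iff)
  then show ?thesis
    by (metis matrix_eq matrix_vector_mult_0)
qed

text \<open>Polynomial functions, without multivariate polynomials: the restriction to every line is
  a univariate polynomial.\<close>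

definition linewise_polynomial :: "('a::real_vector \<Rightarrow> real) \<Rightarrow> bool" where
  "linewise_polynomial f \<longleftrightarrow> (\<forall>y v. \<exists>p. \<forall>t. f (y + t *\<^sub>R v) = poly p t)"

lemma linewise_polynomial_const: "linewise_polynomial (\<lambda>y. c)"
  unfolding linewise_polynomial_def by (intro allI exI[of _ "[:c:]"]) simp

lemma linewise_polynomial_add:
  assumes "linewise_polynomial f" "linewise_polynomial g"
  shows "linewise_polynomial (\<lambda>y. f y + g y)"
  using assms unfolding linewise_polynomial_def by (metis poly_add)

lemma linewise_polynomial_diff:
  assumes "linewise_polynomial f" "linewise_polynomial g"
  shows "linewise_polynomial (\<lambda>y. f y - g y)"
  using assms unfolding linewise_polynomial_def by (metis poly_diff)

lemma linewise_polynomial_mult: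
  assumes "linewise_polynomial f" "linewise_polynomial g"
  shows "linewise_polynomial (\<lambda>y. f y * g y)"
  using assms unfolding linewise_polynomial_def by (metis poly_mult)

lemma linewise_polynomial_inner: "linewise_polynomial (\<lambda>y. b \<bullet> y)"
  unfolding linewise_polynomial_def
proof (intro allI exI)
  fix y v t
  show "b \<bullet> (y + t *\<^sub>R v) = poly [:b \<bullet> y, b \<bullet> v:] t"
    by (simp add: inner_add_right)
qed

lemma linewise_polynomial_quadratic_form:
  fixes B :: "real^'n^'n"
  shows "linewise_polynomial (\<lambda>y. y \<bullet> (B *v y))"
  unfolding linewise_polynomial_def
proof (intro allI exI)
  fix y v t
  show "(y + t *\<^sub>R v) \<bullet> (B *v (y + t *\<^sub>R v)) =
      poly [:y \<bullet> (B *v y), y \<bullet> (B *v v) + v \<bullet> (B *v y), v \<bullet> (B *v v):] t"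
    by (simp add: matrix_vector_right_distrib matrix_vector_mult_scaleR inner_add_left
        inner_add_right distrib_left)
qed

lemmas linewise_polynomial_intros = linewise_polynomial_const linewise_polynomial_add
  linewise_polynomial_diff linewise_polynomial_mult linewise_polynomial_inner
  linewise_polynomial_quadratic_form

text \<open>On the line from \<open>u\<close> to \<open>x\<close> the function is a polynomial that
  vanishes for all parameters near 0. It has infinitely many roots, so it is zero, in particular at
  parameter 1.\<close>

lemma linewise_polynomial_zero_if_locally_zero:
  fixes f :: "'a::real_normed_vector \<Rightarrow> real"
  assumes f: "linewise_polynomial f" and U: "open U" "u \<in> U" and 0: "\<And>y. y \<in> U \<Longrightarrow> f y = 0"
  shows "f x = 0"
proof -
  obtain p where p: "\<And>t. f (u + t *\<^sub>R (x - u)) = poly p t"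
    using f unfolding linewise_polynomial_def by blast
  have "\<forall>\<^sub>F t in nhds (0::real). u + t *\<^sub>R (x - u) \<in> U"
    by (rule eventually_line_in_open[OF U])
  then obtain S where S: "open S" "0 \<in> S" "\<forall>t\<in>S. u + t *\<^sub>R (x - u) \<in> U"
    unfolding eventually_nhds by blast
  then have "S \<subseteq> {t. poly p t = 0}"
    using 0 p by (metis (mono_tags) mem_Collect_eq subsetI)
  moreover have "infinite S"
    using S(1,2) finite_imp_not_open by auto
  ultimately have "p = 0"
    using poly_roots_finite finite_subset by blast
  then show ?thesis using p[of 1] by simp
qed

text \<open>The expansion of the cubic form \<open>a(y,y) c(y) - b(y) r(y,y)\<close> at \<open>y + d + e\<close>, traced over
  \<open>d\<close>, \<open>e\<close> with the inverse of \<open>a\<close>.\<close>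

lemma contraction_of_cubic_identity:
  fixes a r :: "real^'n^'n"
  assumes a: "transpose a = a" and inv: "a ** C = mat 1" and r: "transpose r = r"
    and cubic: "\<And>y. (y \<bullet> (a *v y)) * (c \<bullet> y) = (b \<bullet> y) * (y \<bullet> (r *v y))"
  shows "(real CARD('n) + 2) * (c \<bullet> y) = (C \<bullet> r) * (b \<bullet> y) + 2 * ((r *v (C *v b)) \<bullet> y)"
proof -
  let ?a = "\<lambda>x y. x \<bullet> (a *v y)" and ?r = "\<lambda>x y. x \<bullet> (r *v y)"
  have asym: "?a x y = ?a y x" and rsym: "?r x y = ?r y x" for x y
    using inner_symmetric_matrix[OF a, of x y] inner_symmetric_matrix[OF r, of x y]
    by (simp_all add: inner_commute)
  have polar: "?a d e * (c \<bullet> y) + ?a y d * (c \<bullet> e) + ?a y e * (c \<bullet> d) =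
      (b \<bullet> y) * ?r d e + ?r y d * (b \<bullet> e) + ?r y e * (b \<bullet> d)" for d e y
  proof -
    \<comment> \<open>The alternating sum of \<open>?h\<close> below isolates the part linear in
      each of \<open>y\<close>, \<open>d\<close> and \<open>e\<close>; it is zero because
      \<open>?h\<close> vanishes identically.\<close>
    let ?h = "\<lambda>y. ?a y y * (c \<bullet> y) - (b \<bullet> y) * ?r y y"
    have "?h (y + d + e) - ?h (y + d) - ?h (y + e) - ?h (d + e) + ?h y + ?h d + ?h e =
        2 * (?a d e * (c \<bullet> y) + ?a y d * (c \<bullet> e) + ?a y e * (c \<bullet> d)
        - ((b \<bullet> y) * ?r d e + ?r y d * (b \<bullet> e) + ?r y e * (b \<bullet> d)))"
      unfolding matrix_vector_right_distrib inner_add_left inner_add_right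
        asym[of d y] asym[of e y] asym[of e d] rsym[of d y] rsym[of e y] rsym[of e d]
      by algebra
    then show ?thesis using cubic by simp
  qed
  have CB: "C ** a = mat 1" using inv by (simp add: matrix_left_right_inverse)
  have Csym: "transpose C = C" by (rule symmetric_inverse[OF a inv])
  \<comment> \<open>With basis vectors for \<open>d\<close> and \<open>e\<close> the polarised
    identity becomes an equation of matrices, ready for contraction with \<open>C\<close>.\<close>
  have L: "(c \<bullet> y) *\<^sub>R a + outer (a *v y) c + outer c (a *v y) =
      (b \<bullet> y) *\<^sub>R r + outer (r *v y) b + outer b (r *v y)"
  proof -
    have "axis i 1 \<bullet> (B *v axis j 1) = B $ i $ j" for i j and B :: "real^'n^'n"
      by (simp add: inner_axis' matrix_vector_mult_basis column_def)
    moreover have "y \<bullet> (B *v axis j 1) = (B *v y) $ j" if "transpose B = B" for j and B :: "real^'n^'n"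
      using inner_symmetric_matrix[OF that] by (simp add: inner_axis)
    ultimately show ?thesis
      using polar[of "axis _ 1" "axis _ 1" y] a r
      by (simp add: vec_eq_iff outer_def inner_axis mult_ac)
  qed
  \<comment> \<open>The trace of \<open>a\<close> contributes the dimension and each outer product
    one more \<open>c \<bullet> y\<close>, whence the factor dimension plus 2.\<close>
  have 1: "C \<bullet> ((c \<bullet> y) *\<^sub>R a + outer (a *v y) c + outer c (a *v y)) =
      (c \<bullet> y) * real CARD('n) + (a *v y) \<bullet> (C *v c) + c \<bullet> (C *v (a *v y))"
    using inner_matrix_symmetric_inverse[OF a inv]
    by (simp add: inner_add_right inner_outer inner_commute[of C])
  have 2: "C *v (a *v y) = y" "(a *v y) \<bullet> (C *v c) = c \<bullet> y"
    using CB inner_symmetric_matrix[OF Csym, of "a *v y" c]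
    by (simp_all add: matrix_vector_mul_assoc inner_commute)
  have 3: "C \<bullet> ((b \<bullet> y) *\<^sub>R r + outer (r *v y) b + outer b (r *v y)) =
      (b \<bullet> y) * (C \<bullet> r) + (r *v y) \<bullet> (C *v b) + b \<bullet> (C *v (r *v y))"
    by (simp add: inner_add_right inner_outer inner_commute[of C])
  have 4: "(r *v y) \<bullet> (C *v b) = (r *v (C *v b)) \<bullet> y" "b \<bullet> (C *v (r *v y)) = (r *v (C *v b)) \<bullet> y"
    using inner_symmetric_matrix[OF Csym, of b "r *v y"] inner_symmetric_matrix[OF r, of "C *v b" y]
    by (simp_all add: inner_commute)
  show ?thesis
    using arg_cong[OF L, of "\<lambda>B. C \<bullet> B"] unfolding 1 2 3 4 by (simp add: algebra_simps)
qed

text \<open>By polarisation \<open>r\<close> is \<open>k T\<close> times \<open>a\<close>, where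
  \<open>T\<close> is the trace of \<open>r\<close>. Taking traces gives \<open>T = n k T\<close> in
  dimension \<open>n\<close>, so \<open>T = 0\<close> and with it \<open>r = 0\<close>.\<close>

lemma pure_trace_zero:
  fixes a r :: "real^'n^'n"
  assumes a: "transpose a = a" and inv: "a ** C = mat 1" and r: "transpose r = r"
    and k: "real CARD('n) * k \<noteq> 1"
    and eq: "\<And>y. y \<bullet> (r *v y) = k * (C \<bullet> r) * (y \<bullet> (a *v y))"
  shows "r = 0"
proof -
  have "r - (k * (C \<bullet> r)) *\<^sub>R a = 0"
  proof (rule symmetric_matrix_zero_if_quadratic_form_zero)
    show "transpose (r - (k * (C \<bullet> r)) *\<^sub>R a) = r - (k * (C \<bullet> r)) *\<^sub>R a"
      using a r by (simp add: transpose_def vec_eq_iff)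
    show "y \<bullet> ((r - (k * (C \<bullet> r)) *\<^sub>R a) *v y) = 0" for y
      using eq[of y] by (simp add: matrix_vector_mult_diff_rdistrib inner_diff_right flip: scaleR_matrix_vector_assoc)
  qed
  then have req: "r = (k * (C \<bullet> r)) *\<^sub>R a" by simp
  then have "C \<bullet> r = k * (C \<bullet> r) * real CARD('n)"
    using inner_matrix_symmetric_inverse[OF a inv] by (metis inner_scaleR_right)
  then have "(C \<bullet> r) * (1 - real CARD('n) * k) = 0" by (simp add: algebra_simps)
  then have "C \<bullet> r = 0" using k by simp
  then show ?thesis using req by simp
qed

section \<open>The algebra of the field equation in one fibre\<close>

lemma open_quadratic_form_less:
  fixes B :: "real^'n^'n"
  shows "open {y. k < c * (y \<bullet> (B *v y))}"
  by (intro open_Collect_less continuous_intros linear_continuous_on matrix_vector_mul_bounded_linear)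

text \<open>Here \<open>eq\<close> is the field equation times \<open>F\<close>, with \<alpha>
  written as a square root. It is known only on an open set of vectors of one sign, and the proof
  continues its polynomial consequences to the whole fibre.\<close>

lemma randers_ricci_form_zero:
  fixes a C r :: "real^4^4" and b :: "real^4"
  defines "A \<equiv> \<lambda>y. y \<bullet> (a *v y)" and "R \<equiv> \<lambda>y. y \<bullet> (r *v y)"
    and "S \<equiv> \<lambda>y. (r *v (C *v b)) \<bullet> y" and "T \<equiv> C \<bullet> r"
  assumes a: "transpose a = a" and inv: "a ** C = mat 1" and r: "transpose r = r"
    and indefinite: "0 < A v\<^sub>1" "A v\<^sub>2 < 0" and eps: "\<epsilon> = 1 \<or> \<epsilon> = - 1"
    and U: "open U" "u \<in> U" "\<And>y. y \<in> U \<Longrightarrow> 0 < \<epsilon> * A y"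
    and eq: "\<And>y. y \<in> U \<Longrightarrow> 2 * (A y * (T * (b \<bullet> y) - S y) - (b \<bullet> y) * R y) +
      sqrt (\<epsilon> * A y) * (T * (A y + \<epsilon> * ((b \<bullet> y) * (b \<bullet> y))) - 2 * \<epsilon> * (b \<bullet> y) * S y
        + (\<epsilon> * (b \<bullet> (C *v b)) - 3) * R y) = 0"
  shows "r = 0"
proof -
  define P where "P y = 2 * (A y * (T * (b \<bullet> y) - S y) - (b \<bullet> y) * R y)" for y
  define Q where "Q y = T * (A y + \<epsilon> * ((b \<bullet> y) * (b \<bullet> y))) - 2 * \<epsilon> * (b \<bullet> y) * S y
        + (\<epsilon> * (b \<bullet> (C *v b)) - 3) * R y" for y
  have pol: "linewise_polynomial P" "linewise_polynomial Q"
    unfolding P_def Q_def A_def R_def S_def by (intro linewise_polynomial_intros)+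
  have polA: "linewise_polynomial A"
    unfolding A_def by (rule linewise_polynomial_quadratic_form)
  \<comment> \<open>Squaring \<open>P = - \<alpha> Q\<close> removes the root; the resulting
    polynomial identity spreads from \<open>U\<close> to all vectors.\<close>
  have norm: "P y * P y - \<epsilon> * A y * (Q y * Q y) = 0" for y
  proof (rule linewise_polynomial_zero_if_locally_zero[where f = "\<lambda>y. P y * P y - \<epsilon> * A y * (Q y * Q y)"])
    show "linewise_polynomial (\<lambda>y. P y * P y - \<epsilon> * A y * (Q y * Q y))"
      by (intro linewise_polynomial_intros pol polA)
    fix y assume y: "y \<in> U"
    have "P y = - (sqrt (\<epsilon> * A y) * Q y)"
      using eq[OF y] unfolding P_def Q_def by linarith
    then have "P y * P y = (sqrt (\<epsilon> * A y) * sqrt (\<epsilon> * A y)) * (Q y * Q y)" by simp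
    then show "P y * P y - \<epsilon> * A y * (Q y * Q y) = 0"
      using U(3)[OF y] by simp
  qed (use U in auto)
  \<comment> \<open>The vectors of the sign opposite to that on \<open>U\<close>; indefiniteness
    provides one, namely \<open>v\<^sub>2\<close> for \<epsilon> = 1 and \<open>v\<^sub>1\<close>
    for \<epsilon> = -1.\<close>
  let ?V = "{y. 0 < - \<epsilon> * (y \<bullet> (a *v y))}"
  have V: "open ?V" by (rule open_quadratic_form_less)
  obtain w where w: "w \<in> ?V"
    using indefinite eps that[of v\<^sub>1] that[of v\<^sub>2] by (auto simp: A_def)
  \<comment> \<open>On \<open>?V\<close> the identity is a vanishing sum of two nonnegative
    terms.\<close>
  have PQ: "P y = 0 \<and> Q y = 0" if "y \<in> ?V" for y
  proof -
    have "P y * P y + (- \<epsilon> * A y) * (Q y * Q y) = 0" using norm[of y] by simp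
    moreover have "0 < - \<epsilon> * A y" using that by (simp add: A_def)
    ultimately have "P y * P y = 0" "(- \<epsilon> * A y) * (Q y * Q y) = 0"
      using zero_le_square[of "P y"] zero_le_square[of "Q y"] mult_nonneg_nonneg[of "- \<epsilon> * A y" "Q y * Q y"]
      by linarith+
    then show ?thesis using \<open>0 < - \<epsilon> * A y\<close> by auto
  qed
  have P0: "P y = 0" and Q0: "Q y = 0" for y
    using linewise_polynomial_zero_if_locally_zero[OF pol(1) V w, of y]
      linewise_polynomial_zero_if_locally_zero[OF pol(2) V w, of y] PQ by blast+
  show "r = 0"
  proof (cases "b = 0")
    case True
    then have "S y = 0" for y by (simp add: S_def)
    then have "R y = 1/3 * T * A y" for y
      using Q0[of y] True by (simp add: Q_def)
    then show ?thesis
      unfolding R_def T_def A_def by (intro pure_trace_zero[OF a inv r, of "1/3"]) simp_all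
  next
    case False
    \<comment> \<open>With this covector \<open>P = 0\<close> takes the form of the cubic identity
      to which the contraction lemma applies.\<close>
    let ?c = "T *\<^sub>R b - r *v (C *v b)"
    have c: "?c \<bullet> y = T * (b \<bullet> y) - S y" for y
      by (simp add: inner_diff_left S_def)
    have cubic: "A y * (?c \<bullet> y) = (b \<bullet> y) * R y" for y
      using P0[of y] by (simp add: P_def c)
    have c6: "6 * (?c \<bullet> y) = T * (b \<bullet> y) + 2 * S y" for y
      using contraction_of_cubic_identity[OF a inv r cubic[unfolded A_def R_def], of y]
      by (simp add: T_def S_def)
    \<comment> \<open>Eliminating \<open>S\<close> between \<open>c\<close> and \<open>c6\<close>
      gives \<open>8 (?c \<bullet> y) = 3 T (b \<bullet> y)\<close>; the 6 in \<open>c6\<close> is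
      the dimension 4 plus 2.\<close>
    have c': "?c \<bullet> y = 3/8 * T * (b \<bullet> y)" for y
      using c[of y] c6[of y] by linarith
    \<comment> \<open>The factor \<open>b \<bullet> y\<close> can be cancelled on the open
      half-space where it is positive, and the polynomial then vanishes everywhere.\<close>
    have "R y - 3/8 * T * A y = 0" for y
    proof (rule linewise_polynomial_zero_if_locally_zero[where f = "\<lambda>y. R y - 3/8 * T * A y"])
      show "linewise_polynomial (\<lambda>y. R y - 3/8 * T * A y)"
        unfolding R_def A_def by (intro linewise_polynomial_intros)
      show "open {y. 0 < b \<bullet> y}" by (intro open_Collect_less continuous_intros)
      show "b \<in> {y. 0 < b \<bullet> y}" using False by simp
      show "R y - 3/8 * T * A y = 0" if "y \<in> {y. 0 < b \<bullet> y}" for y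
      proof -
        have "(b \<bullet> y) * (R y - 3/8 * T * A y) = 0"
          using cubic[of y] unfolding c'[of y] by (auto simp: algebra_simps)
        then show ?thesis using that by simp
      qed
    qed
    then show ?thesis
      unfolding R_def T_def A_def by (intro pure_trace_zero[OF a inv r, of "3/8"]) simp_all
  qed
qed

section \<open>The fundamental tensor of a Randers metric\<close>

lemma DERIV_sqrt_abs:
  assumes "c \<noteq> (0::real)"
  shows "((\<lambda>x. sqrt \<bar>x\<bar>) has_field_derivative sgn c / (2 * sqrt \<bar>c\<bar>)) (at c)"
proof (cases "0 < c")
  case True
  have "(sqrt has_field_derivative inverse (sqrt c) / 2) (at c)"
    using True by (rule DERIV_real_sqrt)
  then have "((\<lambda>x. sqrt \<bar>x\<bar>) has_field_derivative inverse (sqrt c) / 2) (at c)"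
    by (rule has_field_derivative_transform_within_open[of _ _ _ "{0<..}"]) (use True in auto)
  then show ?thesis using True by (simp add: field_simps)
next
  case False
  then have c: "c < 0" using assms by simp
  have "((\<lambda>x. sqrt (- x)) has_field_derivative - (inverse (sqrt (- c)) / 2)) (at c)"
    using c by (auto intro!: derivative_eq_intros simp: field_simps)
  then have "((\<lambda>x. sqrt \<bar>x\<bar>) has_field_derivative - (inverse (sqrt (- c)) / 2)) (at c)"
    by (rule has_field_derivative_transform_within_open[of _ _ _ "{..<0}"]) (use c in auto)
  then show ?thesis using c by (simp add: field_simps)
qed

lemma DERIV_sgn_div_sqrt_abs:
  assumes "c \<noteq> (0::real)"
  shows "((\<lambda>x. sgn x / sqrt \<bar>x\<bar>) has_field_derivative - 1 / (2 * sqrt \<bar>c\<bar> ^ 3)) (at c)"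
proof -
  \<comment> \<open>The sign is locally constant away from 0, so it is frozen at its value at
    \<open>c\<close> before differentiating.\<close>
  have "((\<lambda>x. sgn c / sqrt \<bar>x\<bar>) has_field_derivative - 1 / (2 * sqrt \<bar>c\<bar> ^ 3)) (at c)"
    by (rule DERIV_cong[OF DERIV_divide[OF DERIV_const DERIV_sqrt_abs[OF assms]]])
      (use assms in \<open>auto simp: power3_eq_cube sgn_if field_simps\<close>)
  then show ?thesis
    by (rule has_field_derivative_transform_within_open[of _ _ _ "if 0 < c then {0<..} else {..<0}"])
      (use assms in \<open>auto simp: sgn_if\<close>)
qed

text \<open>With \<open>\<alpha> = sqrt \<bar>a(y,y)\<bar>\<close> and \<open>k = sgn (a(y,y)) / \<alpha>\<close>, the fibre derivative of \<open>\<alpha>\<close> is \<open>k a y\<close>.\<close>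

definition alpha_coeff :: "real^'n^'n \<Rightarrow> real^'n \<Rightarrow> real" where
  "alpha_coeff B y = sgn (y \<bullet> (B *v y)) / sqrt \<bar>y \<bullet> (B *v y)\<bar>"

lemma DERIV_alpha:
  fixes B :: "real^'n^'n"
  assumes "transpose B = B" "y \<bullet> (B *v y) \<noteq> 0"
  shows "((\<lambda>t. sqrt \<bar>(y + t *\<^sub>R v) \<bullet> (B *v (y + t *\<^sub>R v))\<bar>) has_field_derivative
    alpha_coeff B y * (v \<bullet> (B *v y))) (at 0)"
proof -
  have "((\<lambda>x. sqrt \<bar>x\<bar>) has_field_derivative sgn (y \<bullet> (B *v y)) / (2 * sqrt \<bar>y \<bullet> (B *v y)\<bar>))
      (at ((y + 0 *\<^sub>R v) \<bullet> (B *v (y + 0 *\<^sub>R v))))"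
    using DERIV_sqrt_abs[OF assms(2)] by simp
  from DERIV_chain2[OF this DERIV_quadratic_form[OF assms(1)]] show ?thesis
    by (rule DERIV_cong) (simp add: alpha_coeff_def)
qed

lemma DERIV_alpha_coeff:
  fixes B :: "real^'n^'n"
  assumes "transpose B = B" "y \<bullet> (B *v y) \<noteq> 0"
  shows "((\<lambda>t. alpha_coeff B (y + t *\<^sub>R v)) has_field_derivative
    - (v \<bullet> (B *v y)) / sqrt \<bar>y \<bullet> (B *v y)\<bar> ^ 3) (at 0)"
proof -
  have "((\<lambda>x. sgn x / sqrt \<bar>x\<bar>) has_field_derivative - 1 / (2 * sqrt \<bar>y \<bullet> (B *v y)\<bar> ^ 3))
      (at ((y + 0 *\<^sub>R v) \<bullet> (B *v (y + 0 *\<^sub>R v))))"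
    using DERIV_sgn_div_sqrt_abs[OF assms(2)] by simp
  from DERIV_chain2[OF this DERIV_quadratic_form[OF assms(1)]] show ?thesis
    unfolding alpha_coeff_def by (rule DERIV_cong) simp
qed

lemma randers_alpha_eq: "randers_alpha a z = sqrt \<bar>snd z \<bullet> (a (fst z) *v snd z)\<bar>"
  by (simp add: randers_alpha_def inner_vec_def matrix_vector_mult_def sum_distrib_left mult_ac)

lemma randers_beta_eq: "randers_beta b z = b (fst z) \<bullet> snd z"
  by (simp add: randers_beta_def inner_vec_def)

context
  fixes D :: "((real^4) \<times> (real^4)) set" and f :: cfun
    and a :: "real^4 \<Rightarrow> real^4^4" and b :: "real^4 \<Rightarrow> real^4"
  assumes D: "open D"
    and sym: "\<And>z. z \<in> D \<Longrightarrow> transpose (a (fst z)) = a (fst z)"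
    and alpha: "\<And>z. z \<in> D \<Longrightarrow> randers_alpha a z \<noteq> 0"
    and f: "\<And>z. z \<in> D \<Longrightarrow> f z = randers_alpha a z + randers_beta b z"
begin

lemma dy_lagr_randers:
  assumes z: "z \<in> D"
  shows "dy \<nu> (lagr f) z =
    2 * f z * (alpha_coeff (a (fst z)) (snd z) * (a (fst z) *v snd z) $ \<nu> + b (fst z) $ \<nu>)"
proof -
  let ?y = "snd z" and ?B = "a (fst z)"
  let ?F = "\<lambda>y. sqrt \<bar>y \<bullet> (?B *v y)\<bar> + b (fst z) \<bullet> y"
  have B: "transpose ?B = ?B" "?y \<bullet> (?B *v ?y) \<noteq> 0"
    using sym[OF z] alpha[OF z] by (auto simp: randers_alpha_eq)
  have dF: "((\<lambda>t. ?F (?y + t *\<^sub>R axis \<nu> 1)) has_field_derivative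
      alpha_coeff ?B ?y * (axis \<nu> 1 \<bullet> (?B *v ?y)) + b (fst z) $ \<nu>) (at 0)"
    by (intro DERIV_add DERIV_alpha B)
      (auto intro!: derivative_eq_intros simp: inner_axis inner_add_right)
  have "dy \<nu> (lagr f) z = dy \<nu> (\<lambda>z. (sqrt \<bar>snd z \<bullet> (a (fst z) *v snd z)\<bar> + b (fst z) \<bullet> snd z)\<^sup>2) z"
    by (rule dy_cong[OF D z]) (simp add: lagr_def f randers_alpha_eq randers_beta_eq)
  also have "\<dots> = 2 * f z * (alpha_coeff ?B ?y * (?B *v ?y) $ \<nu> + b (fst z) $ \<nu>)"
    unfolding dy_def fst_conv snd_conv power2_eq_square
    by (rule DERIV_imp_deriv, rule DERIV_cong[OF DERIV_mult[OF dF dF]])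
      (simp add: f z randers_alpha_eq randers_beta_eq inner_axis')
  finally show ?thesis .
qed

text \<open>Half the Hessian of F^2 is F times the Hessian of F plus the square of the gradient
  \<open>m\<close> of F. Since \<beta> is linear, the Hessian of F is that of \<alpha>, namely k B
  minus w w / \<alpha>^3.\<close>

lemma fund_tensor_randers:
  fixes z
  defines "y \<equiv> snd z" and "B \<equiv> a (fst z)"
  defines "k \<equiv> alpha_coeff B y" and "w \<equiv> B *v y"
  defines "m \<equiv> k *\<^sub>R w + b (fst z)"
  assumes z: "z \<in> D"
  shows "fund_tensor f z = (f z * k) *\<^sub>R B - (f z / randers_alpha a z ^ 3) *\<^sub>R outer w w + outer m m"
proof -
  have B: "transpose B = B" "y \<bullet> (B *v y) \<noteq> 0"
    using sym[OF z] alpha[OF z] by (auto simp: B_def y_def randers_alpha_eq)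
  have "1/2 * dy \<mu> (dy \<nu> (lagr f)) z = f z * (k * B $ \<mu> $ \<nu> - w $ \<mu> * w $ \<nu> / randers_alpha a z ^ 3) + m $ \<mu> * m $ \<nu>"
    for \<mu> \<nu>
  proof -
    have "dy \<mu> (dy \<nu> (lagr f)) z = dy \<mu> (\<lambda>z. 2 * (sqrt \<bar>snd z \<bullet> (a (fst z) *v snd z)\<bar> + b (fst z) \<bullet> snd z) *
        (alpha_coeff (a (fst z)) (snd z) * (axis \<nu> 1 \<bullet> (a (fst z) *v snd z)) + b (fst z) $ \<nu>)) z"
      by (rule dy_cong[OF D z])
        (simp add: dy_lagr_randers, simp add: f randers_alpha_eq randers_beta_eq inner_axis')
    also have "\<dots> = 2 * (k * w $ \<mu> + b (fst z) $ \<mu>) * (k * w $ \<nu> + b (fst z) $ \<nu>) +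
        2 * f z * (- w $ \<mu> / randers_alpha a z ^ 3 * w $ \<nu> + k * (axis \<nu> 1 \<bullet> (B *v axis \<mu> 1)))"
      unfolding dy_def fst_conv snd_conv y_def[symmetric] B_def[symmetric]
    proof (rule DERIV_imp_deriv)
      have 1: "((\<lambda>t. b (fst z) \<bullet> (y + t *\<^sub>R axis \<mu> 1)) has_field_derivative b (fst z) $ \<mu>) (at 0)"
        by (auto intro!: derivative_eq_intros simp: inner_axis inner_add_right)
      have 2: "((\<lambda>t. axis \<nu> 1 \<bullet> (B *v (y + t *\<^sub>R axis \<mu> 1))) has_field_derivative axis \<nu> 1 \<bullet> (B *v axis \<mu> 1)) (at 0)"
        by (auto intro!: derivative_eq_intros simp: matrix_vector_right_distrib matrix_vector_mult_scaleR inner_add_right)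
      have 3: "((\<lambda>t. alpha_coeff B (y + t *\<^sub>R axis \<mu> 1)) has_field_derivative - w $ \<mu> / randers_alpha a z ^ 3) (at 0)"
        using DERIV_alpha_coeff[OF B, of "axis \<mu> 1"]
        by (simp add: inner_axis' w_def randers_alpha_eq B_def y_def)
      have 4: "((\<lambda>t. sqrt \<bar>(y + t *\<^sub>R axis \<mu> 1) \<bullet> (B *v (y + t *\<^sub>R axis \<mu> 1))\<bar>) has_field_derivative k * w $ \<mu>) (at 0)"
        using DERIV_alpha[OF B, of "axis \<mu> 1"] by (simp add: inner_axis' w_def k_def)
      have fz: "f z = sqrt \<bar>y \<bullet> (B *v y)\<bar> + b (fst z) \<bullet> y"
        by (simp add: f z randers_alpha_eq randers_beta_eq B_def y_def)
      show "((\<lambda>t. 2 * (sqrt \<bar>(y + t *\<^sub>R axis \<mu> 1) \<bullet> (B *v (y + t *\<^sub>R axis \<mu> 1))\<bar> + b (fst z) \<bullet> (y + t *\<^sub>R axis \<mu> 1)) *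
          (alpha_coeff B (y + t *\<^sub>R axis \<mu> 1) * (axis \<nu> 1 \<bullet> (B *v (y + t *\<^sub>R axis \<mu> 1))) + b (fst z) $ \<nu>))
        has_field_derivative 2 * (k * w $ \<mu> + b (fst z) $ \<mu>) * (k * w $ \<nu> + b (fst z) $ \<nu>) +
        2 * f z * (- w $ \<mu> / randers_alpha a z ^ 3 * w $ \<nu> + k * (axis \<nu> 1 \<bullet> (B *v axis \<mu> 1)))) (at 0)"
        by (rule DERIV_cong[OF DERIV_mult[OF DERIV_cmult[OF DERIV_add[OF 4 1]] DERIV_add[OF DERIV_mult[OF 3 2] DERIV_const]]])
          (simp add: fz inner_axis' k_def w_def mult_ac)
    qed
    also have "axis \<nu> 1 \<bullet> (B *v axis \<mu> 1) = B $ \<mu> $ \<nu>"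
      using arg_cong[OF B(1), of "\<lambda>M. M $ \<mu> $ \<nu>"]
      by (simp add: inner_axis' matrix_vector_mult_basis column_def transpose_def)
    finally have eq: "dy \<mu> (dy \<nu> (lagr f)) z = 2 * (k * w $ \<mu> + b (fst z) $ \<mu>) * (k * w $ \<nu> + b (fst z) $ \<nu>) +
        2 * f z * (- w $ \<mu> / randers_alpha a z ^ 3 * w $ \<nu> + k * B $ \<mu> $ \<nu>)" .
    show ?thesis unfolding eq by (simp add: m_def algebra_simps)
  qed
  then show ?thesis
    by (simp add: fund_tensor_def vec_eq_iff outer_def algebra_simps)
qed

end

text \<open>The inverse has the classical form known for Randers metrics in Riemannian signature, with
  \<open>\<epsilon>\<close> the sign of \<open>a(y,y)\<close>.\<close>

lemma
  fixes B C :: "real^'n^'n" and b y :: "real^'n" and F \<alpha> \<epsilon> :: real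
  defines "w \<equiv> B *v y" and "u \<equiv> C *v b"
  defines "m \<equiv> (\<epsilon> / \<alpha>) *\<^sub>R w + b"
  defines "g \<equiv> (F * (\<epsilon> / \<alpha>)) *\<^sub>R B - (F / \<alpha> ^ 3) *\<^sub>R outer w w + outer m m"
  assumes B: "transpose B = B" and inv: "B ** C = mat 1"
    and eps: "\<epsilon> = 1 \<or> \<epsilon> = -1" and pos: "\<alpha> > 0" and alpha: "y \<bullet> (B *v y) = \<epsilon> * \<alpha>\<^sup>2"
    and F: "F = \<alpha> + b \<bullet> y"
  shows randers_fund_tensor_vertical: "g *v y = F *\<^sub>R m"
    and randers_fund_tensor_inverse: "F \<noteq> 0 \<Longrightarrow> g ** ((\<alpha> * \<epsilon> / F) *\<^sub>R C +
      ((b \<bullet> y + \<alpha> * \<epsilon> * (b \<bullet> u)) / F ^ 3) *\<^sub>R outer y y -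
      (\<alpha> * \<epsilon> / F\<^sup>2) *\<^sub>R (outer y u + outer u y)) = mat 1" (is "_ \<Longrightarrow> g ** ?X = _")
proof -
  have Csym: "transpose C = C" by (rule symmetric_inverse[OF B inv])
  have BC: "B *v (C *v v) = v" for v
    using inv by (simp add: matrix_vector_mul_assoc)
  have gx: "g *v x = (F * (\<epsilon> / \<alpha>)) *\<^sub>R (B *v x) - (F / \<alpha> ^ 3 * (w \<bullet> x)) *\<^sub>R w + (m \<bullet> x) *\<^sub>R m" for x
    unfolding g_def
    by (simp add: matrix_vector_mult_add_rdistrib matrix_vector_mult_diff_rdistrib outer_mult_vector
        flip: scaleR_matrix_vector_assoc)
  have wC: "w \<bullet> (C *v v) = y \<bullet> v" for v
    using inner_symmetric_matrix[OF B, of y "C *v v"] BC by (simp add: w_def)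
  have wy: "w \<bullet> y = \<epsilon> * \<alpha>\<^sup>2" using alpha by (simp add: w_def inner_commute)
  have my: "m \<bullet> y = F"
    using eps pos by (auto simp: m_def inner_add_left wy F power2_eq_square)
  \<comment> \<open>The two multiples of \<open>w\<close> cancel because
    \<open>w \<bullet> y\<close> is \<epsilon> \<alpha>^2, leaving
    \<open>(m \<bullet> y) m\<close>.\<close>
  have gy: "g *v y = F *\<^sub>R m"
    using pos by (simp add: gx my wy flip: w_def) (simp add: field_simps power2_eq_square power3_eq_cube)
  show "g *v y = F *\<^sub>R m" by (rule gy)
  assume F0: "F \<noteq> 0"
  have "(g ** ?X) *v v = mat 1 *v v" for v
  proof -
    have uv: "u \<bullet> v = b \<bullet> (C *v v)"
      using inner_symmetric_matrix[OF Csym, of b v] by (simp add: u_def)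
    have wu: "w \<bullet> u = b \<bullet> y" unfolding u_def wC by (rule inner_commute)
    have Xv: "?X *v v = (\<alpha> * \<epsilon> / F) *\<^sub>R (C *v v) + ((b \<bullet> y + \<alpha> * \<epsilon> * (b \<bullet> u)) / F ^ 3 * (y \<bullet> v)) *\<^sub>R y
        - (\<alpha> * \<epsilon> / F\<^sup>2) *\<^sub>R ((u \<bullet> v) *\<^sub>R y + (y \<bullet> v) *\<^sub>R u)"
      by (simp add: matrix_vector_mult_add_rdistrib matrix_vector_mult_diff_rdistrib outer_mult_vector
          flip: scaleR_matrix_vector_assoc)
    have gC: "g *v (C *v v) = (F * (\<epsilon> / \<alpha>)) *\<^sub>R v - (F / \<alpha> ^ 3 * (y \<bullet> v)) *\<^sub>R w
        + (\<epsilon> / \<alpha> * (y \<bullet> v) + u \<bullet> v) *\<^sub>R m"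
      by (simp add: gx BC wC uv) (simp add: m_def inner_add_left wC)
    have gu: "g *v u = (F * (\<epsilon> / \<alpha>)) *\<^sub>R b - (F / \<alpha> ^ 3 * (b \<bullet> y)) *\<^sub>R w
        + (\<epsilon> / \<alpha> * (b \<bullet> y) + b \<bullet> u) *\<^sub>R m"
      by (simp add: gx wu) (simp add: m_def inner_add_left wu, simp add: u_def BC)
    \<comment> \<open>Expressing \<beta> through \<open>F\<close> and \<alpha> turns the remaining
      check into a rational identity in independent quantities.\<close>
    have beta: "b \<bullet> y = F - \<alpha>" using F by simp
    have "g *v (?X *v v) = v"
      unfolding Xv
      by (simp only: matrix_vector_right_distrib matrix_vector_mult_diff_distrib matrix_vector_mult_scaleR gC gu gy)
        (use eps in \<open>auto simp: beta vec_eq_iff m_def field_simps F0 less_imp_neq[OF pos, symmetric] power2_eq_square power3_eq_cube\<close>)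
    then show ?thesis by (simp add: matrix_vector_mul_assoc)
  qed
  then show "g ** ?X = mat 1" by (metis matrix_eq)
qed

section \<open>The vacuum equation\<close>

lemma field_eq_lhs_eq:
  assumes "\<And>\<mu> \<nu>. ricci_tensor f \<mu> \<nu> z = r $ \<mu> $ \<nu>"
  shows "field_eq_lhs f z = (lagr f z *\<^sub>R fund_tensor_inv f z - 3 *\<^sub>R outer (snd z) (snd z)) \<bullet> r"
  by (simp add: field_eq_lhs_def assms inner_vec_def outer_def algebra_simps)

text \<open>The factor \<open>F\<close> clears the denominators. After expanding
  \<open>F = \<alpha> + \<beta>\<close>, even powers of \<alpha> are polynomials in y through
  \<open>A = \<epsilon> \<alpha>^2\<close>, and the odd ones leave a single factor \<alpha>.\<close>

lemma randers_field_equation_split: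
  fixes C r :: "real^'n^'n"
  assumes r: "transpose r = r" and F: "F = \<alpha> + b \<bullet> y" "F \<noteq> 0" and alpha: "A = \<epsilon> * \<alpha>\<^sup>2"
  shows "F * ((F\<^sup>2 *\<^sub>R ((\<alpha> * \<epsilon> / F) *\<^sub>R C +
      ((b \<bullet> y + \<alpha> * \<epsilon> * (b \<bullet> (C *v b))) / F ^ 3) *\<^sub>R outer y y -
      (\<alpha> * \<epsilon> / F\<^sup>2) *\<^sub>R (outer y (C *v b) + outer (C *v b) y)) - 3 *\<^sub>R outer y y) \<bullet> r) =
    2 * (A * ((C \<bullet> r) * (b \<bullet> y) - (r *v (C *v b)) \<bullet> y) - (b \<bullet> y) * (y \<bullet> (r *v y))) +
    \<alpha> * ((C \<bullet> r) * (A + \<epsilon> * ((b \<bullet> y) * (b \<bullet> y))) - 2 * \<epsilon> * (b \<bullet> y) * ((r *v (C *v b)) \<bullet> y)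
      + (\<epsilon> * (b \<bullet> (C *v b)) - 3) * (y \<bullet> (r *v y)))"
proof -
  have S: "y \<bullet> (r *v (C *v b)) = (r *v (C *v b)) \<bullet> y" "(C *v b) \<bullet> (r *v y) = (r *v (C *v b)) \<bullet> y"
    using inner_symmetric_matrix[OF r, of "C *v b" y] by (simp_all add: inner_commute)
  have clear: "F * (F\<^sup>2 * (\<alpha> * \<epsilon> / F * T + K / F ^ 3 * R - \<alpha> * \<epsilon> / F\<^sup>2 * S) - 3 * R) =
      \<alpha> * \<epsilon> * F\<^sup>2 * T + K * R - \<alpha> * \<epsilon> * F * S - 3 * F * R" for K T R S
    using F(2) by (simp add: right_diff_distrib distrib_left power2_eq_square power3_eq_cube)
  show ?thesis
    unfolding inner_diff_left inner_add_left inner_scaleR_left inner_outer S clear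
    unfolding alpha F(1) by (simp add: algebra_simps power2_eq_square)
qed

text \<open>The columns of \<open>P\<close> are a frame in which \<open>a\<close> is diagonal with
  entries 1 and -1. So \<open>a\<close> is symmetric and invertible, and the first two frame vectors
  have squares \<open>-s\<close> and \<open>s\<close> of opposite sign.\<close>

lemma lorentzian_form:
  fixes a P :: "real^4^4"
  assumes s: "s = 1 \<or> s = (-1::real)" and P: "invertible P"
    and J: "transpose P ** a ** P = (\<chi> i j. if i = j then (if i = 1 then - s else s) else 0)" (is "_ = ?J")
  shows "transpose a = a" "a ** matrix_inv a = mat 1"
    "\<exists>v. 0 < v \<bullet> (a *v v)" "\<exists>v. v \<bullet> (a *v v) < 0"
proof -
  let ?K = "matrix_inv P"
  have K: "P ** ?K = mat 1" using P by (rule matrix_inv_mult)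
  then have KT: "transpose ?K ** transpose P = mat 1"
    by (metis matrix_transpose_mul transpose_mat)
  have "a = (transpose ?K ** transpose P) ** a ** (P ** ?K)"
    by (simp add: K KT)
  also have "\<dots> = transpose ?K ** ?J ** ?K"
    by (simp add: J[symmetric] matrix_mul_assoc)
  finally have a: "a = transpose ?K ** ?J ** ?K" .
  have JT: "transpose ?J = ?J"
    by (simp add: transpose_def vec_eq_iff)
  have "transpose (transpose ?K ** ?J ** ?K) = transpose ?K ** ?J ** ?K"
    by (simp only: matrix_transpose_mul JT transpose_transpose matrix_mul_assoc)
  then show "transpose a = a" by (simp only: a[symmetric])
  have "det ?J = (\<Prod>i\<in>UNIV. ?J $ i $ i)"
    by (rule det_diagonal) simp
  also have "\<dots> \<noteq> 0" using s by auto
  finally have "det a \<noteq> 0"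
    using arg_cong[OF J, of det] by (auto simp: det_mul)
  then show "a ** matrix_inv a = mat 1"
    by (simp add: invertible_det_nz matrix_inv_mult)
  have val: "(P *v axis i 1) \<bullet> (a *v (P *v axis i 1)) = ?J $ i $ i" for i
  proof -
    have "(P *v x) \<bullet> z = x \<bullet> (transpose P *v z)" for x z
      by (metis dot_lmul_matrix transpose_matrix_vector transpose_transpose)
    then have "(P *v axis i 1) \<bullet> (a *v (P *v axis i 1)) = axis i 1 \<bullet> ((transpose P ** a ** P) *v axis i 1)"
      by (simp only: matrix_vector_mul_assoc matrix_mul_assoc)
    then show ?thesis
      by (simp only: J) (simp add: inner_axis' matrix_vector_mult_basis column_def)
  qed
  have ne: "(2::4) \<noteq> 1" by simp
  have "(P *v axis 1 1) \<bullet> (a *v (P *v axis 1 1)) = - s" "(P *v axis 2 1) \<bullet> (a *v (P *v axis 2 1)) = s"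
    unfolding val using ne by simp_all
  then show "\<exists>v. 0 < v \<bullet> (a *v v)" "\<exists>v. v \<bullet> (a *v v) < 0"
    using s by (metis neg_0_less_iff_less neg_less_0_iff_less verit_minus_simplify(4) zero_less_one)+
qed

text \<open>Over a fixed base point \<open>x\<close> the matrices \<open>a x\<close> and
  \<open>Q x\<close> and the covector \<open>b x\<close> are constant, so the field equation becomes
  a condition in y alone, to which \<open>randers_ricci_form_zero\<close> applies.\<close>

lemma randers_berwald_vacuum_imp_ricci_zero:
  fixes D :: "((real^4) \<times> (real^4)) set"
  assumes D: "open D"
    and alpha: "\<And>z. z \<in> D \<Longrightarrow> randers_alpha a z \<noteq> 0"
    and f: "\<And>z. z \<in> D \<Longrightarrow> f z = randers_alpha a z + randers_beta b z"
    and det: "\<And>z. z \<in> D \<Longrightarrow> det (fund_tensor f z) \<noteq> 0"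
    and Q: "\<And>x. transpose (Q x) = Q x"
    and ric: "\<And>z \<mu> \<nu>. z \<in> D \<Longrightarrow> ricci_tensor f \<mu> \<nu> z = Q (fst z) $ \<mu> $ \<nu>"
    and lor: "s = 1 \<or> s = (-1::real)" "\<And>z. z \<in> D \<Longrightarrow> \<exists>P :: real^4^4. invertible P \<and>
        transpose P ** a (fst z) ** P = (\<chi> i j. if i = j then (if i = 1 then - s else s) else 0)"
    and vac: "\<And>z. z \<in> D \<Longrightarrow> field_eq_lhs f z = 0"
    and z: "z \<in> D"
  shows "Q (fst z) = 0"
proof -
  have sym: "transpose (a (fst z)) = a (fst z)" if "z \<in> D" for z
    using lor(2)[OF that] lorentzian_form(1)[OF lor(1)] by blast
  define x where "x = fst z"
  define B where "B = a x"
  obtain P :: "real^4^4" where "invertible P" "transpose P ** B ** P = (\<chi> i j. if i = j then (if i = 1 then - s else s) else 0)"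
    using lor(2)[OF z] unfolding B_def x_def by blast
  note B = lorentzian_form[OF lor(1) this]
  define C where "C = matrix_inv B"
  obtain v\<^sub>1 v\<^sub>2 where C: "transpose B = B" "B ** C = mat 1" "0 < v\<^sub>1 \<bullet> (B *v v\<^sub>1)" "v\<^sub>2 \<bullet> (B *v v\<^sub>2) < 0"
    using B unfolding C_def by blast
  define \<epsilon> where "\<epsilon> = sgn (snd z \<bullet> (B *v snd z))"
  \<comment> \<open>The part of the fibre of \<open>D\<close> over \<open>x\<close> on which
    \<open>a(y,y)\<close> has the same sign as at \<open>z\<close>, so that \<alpha> is the root of
    \<epsilon> \<open>a(y,y)\<close> throughout.\<close>
  define U where "U = Pair x -` D \<inter> {y. 0 < \<epsilon> * (y \<bullet> (B *v y))}"
  have A0: "snd z \<bullet> (B *v snd z) \<noteq> 0"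
    using alpha[OF z] by (auto simp: randers_alpha_eq B_def x_def)
  have eps: "\<epsilon> = 1 \<or> \<epsilon> = -1"
    using A0 by (auto simp: \<epsilon>_def sgn_if)
  show ?thesis
    unfolding x_def[symmetric]
  proof (rule randers_ricci_form_zero[OF C(1,2) Q C(3,4) eps])
    show "open U"
      unfolding U_def by (intro open_Int open_vimage D open_quadratic_form_less continuous_intros)
    show "snd z \<in> U"
      using z A0 by (auto simp: U_def x_def \<epsilon>_def sgn_if)
  next
    fix y assume y: "y \<in> U"
    then show "0 < \<epsilon> * (y \<bullet> (B *v y))" by (simp add: U_def)
    then have abs: "\<bar>y \<bullet> (B *v y)\<bar> = \<epsilon> * (y \<bullet> (B *v y))" and sgn: "sgn (y \<bullet> (B *v y)) = \<epsilon>"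
      using eps by (auto simp: sgn_if)
    have yD: "(x, y) \<in> D" using y by (simp add: U_def)
    let ?\<alpha> = "sqrt (\<epsilon> * (y \<bullet> (B *v y)))" and ?F = "f (x, y)"
    have pos: "0 < ?\<alpha>" using \<open>0 < \<epsilon> * (y \<bullet> (B *v y))\<close> by simp
    have \<alpha>: "y \<bullet> (B *v y) = \<epsilon> * ?\<alpha>\<^sup>2"
      using eps \<open>0 < \<epsilon> * (y \<bullet> (B *v y))\<close> by auto
    have ra: "randers_alpha a (x, y) = ?\<alpha>"
      by (simp add: randers_alpha_eq abs flip: B_def)
    have k: "alpha_coeff B y = \<epsilon> / ?\<alpha>"
      unfolding alpha_coeff_def sgn abs ..
    have F: "?F = ?\<alpha> + b x \<bullet> y"
      using f[OF yD] by (simp add: ra randers_beta_eq)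
    let ?w = "B *v y"
    let ?m = "(\<epsilon> / ?\<alpha>) *\<^sub>R ?w + b x"
    have g: "fund_tensor f (x, y) =
        (?F * (\<epsilon> / ?\<alpha>)) *\<^sub>R B - (?F / ?\<alpha> ^ 3) *\<^sub>R outer ?w ?w + outer ?m ?m"
      using fund_tensor_randers[OF D sym alpha f yD] by (simp add: ra k flip: B_def)
    note inv_assms = C(1,2) eps pos \<alpha> F
    \<comment> \<open>A zero of \<open>F\<close> would put the nonzero vector \<open>y\<close> into
      the kernel of the fundamental tensor, which is \<open>F m\<close> on \<open>y\<close>.\<close>
    have F0: "?F \<noteq> 0"
    proof
      assume "?F = 0"
      then have "fund_tensor f (x, y) *v y = 0"
        using randers_fund_tensor_vertical[OF inv_assms] unfolding g by simp
      moreover have "y \<noteq> 0" using pos by auto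
      moreover have "matrix_inv (fund_tensor f (x, y)) ** fund_tensor f (x, y) = mat 1"
        using det[OF yD] by (simp add: invertible_det_nz matrix_inv_mult)
      ultimately show False
        by (metis matrix_vector_mul_assoc matrix_vector_mul_lid matrix_vector_mult_0_right)
    qed
    have "fund_tensor_inv f (x, y) = (?\<alpha> * \<epsilon> / ?F) *\<^sub>R C +
      ((b x \<bullet> y + ?\<alpha> * \<epsilon> * (b x \<bullet> (C *v b x))) / ?F ^ 3) *\<^sub>R outer y y -
      (?\<alpha> * \<epsilon> / ?F\<^sup>2) *\<^sub>R (outer y (C *v b x) + outer (C *v b x) y)"
      unfolding fund_tensor_inv_def g
      by (rule matrix_inv_eqI[OF randers_fund_tensor_inverse[OF inv_assms F0]])
    then show "2 * ((y \<bullet> (B *v y)) * ((C \<bullet> Q x) * (b x \<bullet> y) - (Q x *v (C *v b x)) \<bullet> y) - (b x \<bullet> y) * (y \<bullet> (Q x *v y))) +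
      ?\<alpha> * ((C \<bullet> Q x) * (y \<bullet> (B *v y) + \<epsilon> * ((b x \<bullet> y) * (b x \<bullet> y))) - 2 * \<epsilon> * (b x \<bullet> y) * ((Q x *v (C *v b x)) \<bullet> y)
        + (\<epsilon> * (b x \<bullet> (C *v b x)) - 3) * (y \<bullet> (Q x *v y))) = 0"
      using vac[OF yD] field_eq_lhs_eq[of f "(x, y)" "Q x"] ric[OF yD]
      unfolding randers_field_equation_split[OF Q F F0 \<alpha>, of C, symmetric]
      by (simp add: lagr_def)
  qed
qed

lemma randers_berwald_chart:
  fixes D :: "((real^4) \<times> (real^4)) set"
  assumes D: "open D" and smooth: "smooth_on D f"
    and alpha: "\<And>z. z \<in> D \<Longrightarrow> randers_alpha a z \<noteq> 0"
    and f: "\<And>z. z \<in> D \<Longrightarrow> f z = randers_alpha a z + randers_beta b z"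
    and det: "\<And>z. z \<in> D \<Longrightarrow> det (fund_tensor f z) \<noteq> 0"
    and lor: "s = 1 \<or> s = (-1::real)" "\<And>z. z \<in> D \<Longrightarrow> \<exists>P :: real^4^4. invertible P \<and>
        transpose P ** a (fst z) ** P = (\<chi> i j. if i = j then (if i = 1 then - s else s) else 0)"
    and conn: "\<And>z \<rho> \<mu>. z \<in> D \<Longrightarrow> nl_conn f \<rho> \<mu> z = (\<Sum>\<nu>\<in>UNIV. \<Gamma> \<rho> \<mu> \<nu> (fst z) * snd z $ \<nu>)"
  shows "(\<forall>z\<in>D. field_eq_lhs f z = 0) \<longleftrightarrow> (\<forall>z\<in>D. \<forall>\<mu> \<nu>. ricci_tensor f \<mu> \<nu> z = 0)" (is "?V \<longleftrightarrow> ?T")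
    and "(\<forall>z\<in>D. \<forall>\<mu> \<nu>. ricci_tensor f \<mu> \<nu> z = 0) \<longleftrightarrow> (\<forall>z\<in>D. ricci_scalar f z = 0)" (is "_ \<longleftrightarrow> ?S")
proof -
  obtain Q :: "real^4 \<Rightarrow> real^4^4" where Q: "\<And>x. transpose (Q x) = Q x"
    and scal: "\<And>z. z \<in> D \<Longrightarrow> ricci_scalar f z = snd z \<bullet> (Q (fst z) *v snd z)"
    by (rule ricci_scalar_quadratic[OF D smooth det conn]) (assumption, assumption, rule that)
  have ric: "ricci_tensor f \<mu> \<nu> z = Q (fst z) $ \<mu> $ \<nu>" if "z \<in> D" for z \<mu> \<nu>
    by (rule ricci_tensor_quadratic[OF D Q scal that])
  show "?V \<longleftrightarrow> ?T"
  proof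
    assume ?V
    then have "Q (fst z) = 0" if "z \<in> D" for z
      by (intro randers_berwald_vacuum_imp_ricci_zero[OF D alpha f det Q ric lor _ that]) auto
    then show ?T using ric by simp
  qed (simp add: field_eq_lhs_def)
  show "?T \<longleftrightarrow> ?S"
  proof
    assume ?T
    then have "Q (fst z) = 0" if "z \<in> D" for z
      using ric[OF that] that by (simp add: vec_eq_iff)
    then show ?S using scal by simp
  next
    assume S: ?S
    \<comment> \<open>The scalar vanishes on the open set \<open>D\<close>, so its fibre derivatives
      of first and second order do too.\<close>
    have "dy \<nu> (ricci_scalar f) z = 0" if "z \<in> D" for z \<nu>
      using dy_cong[OF D that, of "ricci_scalar f" "\<lambda>_. 0"] S by (simp add: dy_def)
    then have "dy \<mu> (dy \<nu> (ricci_scalar f)) z = 0" if "z \<in> D" for z \<mu> \<nu>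
      using dy_cong[OF D that, of "dy \<nu> (ricci_scalar f)" "\<lambda>_. 0"] by (simp add: dy_def)
    then show ?T by (simp add: ricci_tensor_def)
  qed
qed

section \<open>From charts to the manifold\<close>

text \<open>The chart is injective on base points, and the components in \<open>c\<close> fix those
  in all other charts through the Jacobians; the remaining entries are 0. Thus
  \<open>local_rep\<close> evaluates \<open>F\<close> at the intended vector.\<close>

lemma inj_on_tcoord:
  assumes "smooth_manifold4 M \<A>" "c \<in> \<A>"
  shows "inj_on (tcoord c) (over c (tangent_bundle M \<A>))"
proof (rule inj_onI)
  fix w w' assume w: "w \<in> over c (tangent_bundle M \<A>)" and w': "w' \<in> over c (tangent_bundle M \<A>)"
    and eq: "tcoord c w = tcoord c w'"
  obtain p v p' v' where pv: "w = (p, v)" "w' = (p', v')" by (metis surj_pair)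
  have "is_chart M c" using assms by (simp add: smooth_manifold4_def)
  then have "inj_on (snd c) (fst c)"
    using homeomorphic_imp_injective_map openin_subset unfolding is_chart_def
    by (metis topspace_subtopology_subset)
  then have p: "p = p'"
    using w w' eq pv by (simp add: over_def tcoord_def inj_on_eq_iff)
  have tb: "(p, v) \<in> tangent_bundle M \<A>" "(p, v') \<in> tangent_bundle M \<A>" and "p \<in> fst c"
    using w w' pv p by (auto simp: over_def)
  have "v d = v' d" for d
  proof (cases "d \<in> \<A> \<and> p \<in> fst d")
    case True
    then have "v d = jacobian (transition c d) (at (snd c p)) *v v c"
      "v' d = jacobian (transition c d) (at (snd c p)) *v v' c"
      using tb \<open>p \<in> fst c\<close> assms(2) unfolding tangent_bundle_def mem_Collect_eq prod.case by blast+
    then show ?thesis using eq pv by (simp only: tcoord_def fst_conv snd_conv prod.inject)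
  next
    case False
    then have "v d = 0" "v' d = 0"
      using tb unfolding tangent_bundle_def mem_Collect_eq prod.case by blast+
    then show ?thesis by simp
  qed
  then show "w = w'" using p pv by auto
qed

theorem proposition8p2p4:
  fixes M :: "'m topology" and \<A> :: "'m chart set"
    and W :: "'m tvec set" and F :: "'m tvec \<Rightarrow> real"
  assumes "smooth_manifold4 M \<A>"
    and "conic_subbundle M \<A> W"
    and "randers_metric M \<A> W F"
    and "berwald_type M \<A> W F"
  shows "(vacuum_field_equation M \<A> W F \<longleftrightarrow> ricci_tensor_vanishes M \<A> W F) \<and>
         (ricci_tensor_vanishes M \<A> W F \<longleftrightarrow> ricci_scalar_vanishes M \<A> W F)"
proof -
  from assms(3) obtain a b where fin: "finsler_metric M \<A> W F"
    and lor: "lorentzian_metric \<A> a"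
    and ab: "\<And>c w. c \<in> \<A> \<Longrightarrow> w \<in> over c W \<Longrightarrow> randers_alpha (a c) (tcoord c w) \<noteq> 0 \<and>
      F w = randers_alpha (a c) (tcoord c w) + randers_beta (b c) (tcoord c w)"
    unfolding randers_metric_def by blast
  from lor obtain s :: real where s: "s = 1 \<or> s = -1"
    and J: "\<And>c x. c \<in> \<A> \<Longrightarrow> x \<in> chart_image c \<Longrightarrow> \<exists>P :: real^4^4. invertible P \<and>
        transpose P ** a c x ** P = (\<chi> i j. if i = j then (if i = 1 then - s else s) else 0)"
    unfolding lorentzian_metric_def by blast
  \<comment> \<open>All three equations are imposed chart by chart, so the equivalences can be
    proved in each chart separately.\<close>
  have chart: "((\<forall>z\<in>coord_image c W. field_eq_lhs (local_rep M \<A> c F) z = 0) \<longleftrightarrow>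
      (\<forall>z\<in>coord_image c W. \<forall>\<mu> \<nu>. ricci_tensor (local_rep M \<A> c F) \<mu> \<nu> z = 0)) \<and>
      ((\<forall>z\<in>coord_image c W. \<forall>\<mu> \<nu>. ricci_tensor (local_rep M \<A> c F) \<mu> \<nu> z = 0) \<longleftrightarrow>
      (\<forall>z\<in>coord_image c W. ricci_scalar (local_rep M \<A> c F) z = 0))" if c: "c \<in> \<A>" for c
  proof -
    let ?D = "coord_image c W" and ?f = "local_rep M \<A> c F"
    have D: "open ?D" and smooth: "smooth_on ?D ?f"
      and det: "\<And>z. z \<in> ?D \<Longrightarrow> det (fund_tensor ?f z) \<noteq> 0"
      using assms(2) fin c by (auto simp: conic_subbundle_def finsler_metric_def)
    \<comment> \<open>\<open>local_rep\<close> inverts \<open>tcoord\<close> on the whole tangent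
      bundle over the chart, which contains the part of \<open>W\<close> there.\<close>
    have rep: "?f (tcoord c w) = F w" if "w \<in> over c W" for w
    proof -
      have "w \<in> over c (tangent_bundle M \<A>)"
        using that assms(2) by (auto simp: over_def conic_subbundle_def)
      then show ?thesis
        unfolding local_rep_def comp_def by (simp add: inv_into_f_f[OF inj_on_tcoord[OF assms(1) c]])
    qed
    have alpha: "randers_alpha (a c) z \<noteq> 0"
      and f: "?f z = randers_alpha (a c) z + randers_beta (b c) z" if "z \<in> ?D" for z
      using that ab[OF c] rep by (auto simp: coord_image_def)
    have P: "\<exists>P :: real^4^4. invertible P \<and>
        transpose P ** a c (fst z) ** P = (\<chi> i j. if i = j then (if i = 1 then - s else s) else 0)"
      if "z \<in> ?D" for z
      by (rule J[OF c]) (use that in \<open>auto simp: coord_image_def over_def tcoord_def chart_image_def\<close>)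
    obtain \<Gamma> where \<Gamma>: "\<And>z \<rho> \<mu>. z \<in> ?D \<Longrightarrow> nl_conn ?f \<rho> \<mu> z = (\<Sum>\<nu>\<in>UNIV. \<Gamma> \<rho> \<mu> \<nu> (fst z) * snd z $ \<nu>)"
      using assms(4) c unfolding berwald_type_def by blast
    show ?thesis
      using randers_berwald_chart[OF D smooth alpha f det s P \<Gamma>] by blast
  qed
  show ?thesis
    unfolding vacuum_field_equation_def ricci_tensor_vanishes_def ricci_scalar_vanishes_def
    using chart by blast
qed

end
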